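(* Let $\sigma>\frac94$ and let $\phi:\mathbb{R}^2\to\mathbb{R}$ satisfy, for some $C_1>0$, $$|\phi(x,y)|\le C_1\langle x\rangle^{-\sigma}\ \text{ for } x>0,\ y\in\mathbb{R},\qquad \|\langle x\rangle^{-1}\phi(x,y)\|_{L^2_{y\in\mathbb{R},\,x<0}}\le C_1 .$$ Let $\Phi(x,y,t)=\iint A(x',y',t)\,\phi(x+t-x',y-y')\,dx'\,dy'$. Then for $t>0$, $x>0$ and $y\in\mathbb{R}$, $$|\Phi(x,y,t)|\lesssim C_1\begin{cases}t^{-7/12}\langle x\rangle^{-\sigma+\frac74}&\text{if }t<1,\\ t^{-13/12}\langle x\rangle^{-\tilde\sigma}&\text{if }t>1,\end{cases}$$ where $\tilde\sigma=\min(\frac23\sigma-\frac34,\ \sigma-\frac94)$.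
   Context: For $t>0$, $A(x,y,t)=\iint_{\mathbb{R}^2}e^{i(t\xi^3+t\xi\eta^2+x\xi+y\eta)}\,d\xi\,d\eta$, understood as an oscillatory integral (it is a smooth function of $(x,y)$). $\langle x\rangle=(1+x^2)^{1/2}$. $\lesssim$ denotes an inequality up to a multiplicative constant independent of $\phi,C_1,x,y,t$ (it may depend on $\sigma$). *)

theory Defs
  imports "HOL-Analysis.Analysis"
begin

definition japanese :: "real \<Rightarrow> real" where
  "japanese x = sqrt (1 + x\<^sup>2)"

text \<open>
  The integral defining the fundamental solution does not converge absolutely. As an oscillatory
  integral it is the limit of the absolutely convergent integrals obtained by inserting a cut-off
  \<open>\<chi> (\<delta> \<xi>, \<delta> \<eta>)\<close> with \<open>\<chi>\<close> Schwartz and \<open>\<chi> (0, 0) = 1\<close>, as \<open>\<delta>\<close> tends to \<open>0\<close>; the value does not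
  depend on \<open>\<chi>\<close>. Here \<open>\<chi> (\<xi>, \<eta>) = exp (- (\<xi>\<^sup>2 + \<eta>\<^sup>2))\<close> and \<open>\<epsilon> = \<delta>\<^sup>2\<close>.
\<close>

definition Airy_reg :: "real \<Rightarrow> real \<Rightarrow> real \<Rightarrow> real \<Rightarrow> complex" where
  "Airy_reg \<epsilon> x y t =
     (\<integral>(\<xi>, \<eta>). complex_of_real (exp (- \<epsilon> * (\<xi>\<^sup>2 + \<eta>\<^sup>2))) *
        exp (\<i> * complex_of_real (t * \<xi> ^ 3 + t * \<xi> * \<eta>\<^sup>2 + x * \<xi> + y * \<eta>))
      \<partial>(lborel :: (real \<times> real) measure))"

definition Airy_kernel :: "real \<Rightarrow> real \<Rightarrow> real \<Rightarrow> complex" where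
  "Airy_kernel x y t = Lim (at_right 0) (\<lambda>\<epsilon>. Airy_reg \<epsilon> x y t)"

definition Phi_integrand ::
  "(real \<Rightarrow> real \<Rightarrow> real) \<Rightarrow> real \<Rightarrow> real \<Rightarrow> real \<Rightarrow> real \<times> real \<Rightarrow> complex" where
  "Phi_integrand \<phi> x y t =
     (\<lambda>(x', y'). Airy_kernel x' y' t * complex_of_real (\<phi> (x + t - x') (y - y')))"

definition Phi :: "(real \<Rightarrow> real \<Rightarrow> real) \<Rightarrow> real \<Rightarrow> real \<Rightarrow> real \<Rightarrow> complex" where
  "Phi \<phi> x y t = (\<integral>z. Phi_integrand \<phi> x y t z \<partial>lebesgue)"

text \<open>
  The Bochner integral of a non-integrable function is \<open>0\<close>, so a bound on the norm has to be
  accompanied by square-integrability.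
\<close>

definition L2_on :: "(real \<times> real) set \<Rightarrow> (real \<times> real \<Rightarrow> real) \<Rightarrow> bool" where
  "L2_on S f \<longleftrightarrow>
     set_borel_measurable lebesgue S f \<and> set_integrable lebesgue S (\<lambda>z. (f z)\<^sup>2)"

definition L2_norm_on :: "(real \<times> real) set \<Rightarrow> (real \<times> real \<Rightarrow> real) \<Rightarrow> real" where
  "L2_norm_on S f = sqrt (set_lebesgue_integral lebesgue S (\<lambda>z. (f z)\<^sup>2))"

definition admissible :: "real \<Rightarrow> real \<Rightarrow> (real \<Rightarrow> real \<Rightarrow> real) \<Rightarrow> bool" where
  "admissible \<sigma> C\<^sub>1 \<phi> \<longleftrightarrow>
     (\<lambda>(x, y). \<phi> x y) \<in> borel_measurable lebesgue \<and>
     (\<forall>x y. x > 0 \<longrightarrow> \<bar>\<phi> x y\<bar> \<le> C\<^sub>1 * japanese x powr (- \<sigma>)) \<and>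
     L2_on ({..<0} \<times> UNIV) (\<lambda>(x, y). inverse (japanese x) * \<phi> x y) \<and>
     L2_norm_on ({..<0} \<times> UNIV) (\<lambda>(x, y). inverse (japanese x) * \<phi> x y) \<le> C\<^sub>1"

end

theory Submission
  imports Defs "HOL-Complex_Analysis.Complex_Analysis"
begin

text \<open>
  The substitution \<open>\<xi> = \<mu> + \<nu>\<close>, \<open>\<eta> = sqrt 3 (\<mu> - \<nu>)\<close> turns \<open>\<xi>\<^sup>3 + \<xi> \<eta>\<^sup>2\<close> into \<open>4 (\<mu>\<^sup>3 + \<nu>\<^sup>3)\<close>, so the
  kernel is a product of two Airy functions of \<open>(x \<plusminus> sqrt 3 y) / \<tau>\<close>, where \<open>\<tau> = (12 t) powr (1/3)\<close>.
  Moving the \<open>\<xi>\<close>-contour into the upper half plane makes all integrals absolutely convergent and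
  gives exponential decay of the Airy function to the right; its Airy equation gives the decay
  \<open>|s| powr (-1/4)\<close> to the left. Hence, for \<open>x < 0\<close>, the kernel is at most
  \<open>\<tau>\<^sup>-\<^sup>2 (1 + |x|/\<tau>) powr (-1/4)\<close> with exponential decay outside \<open>|y| \<le> |x|\<close>, and for \<open>x > 0\<close> it is
  exponentially small in \<open>x/\<tau>\<close> and \<open>|y|/\<tau>\<close>.
  No further cancellation is needed: putting absolute values inside the convolution, with
  \<open>u = x + t\<close>, every part of it is \<open>O (t powr (-7/12) (1 + u) powr (7/4 - \<sigma>))\<close>. The part where \<open>\<phi>\<close> is
  evaluated on the left half plane is handled by Cauchy--Schwarz and exponential smallness of the
  kernel. For \<open>t > 1\<close>, half a power of \<open>1 + u \<ge> t\<close> is traded for \<open>t powr (-1/2)\<close>.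
\<close>

section \<open>Exponential integrals\<close>

lemma nn_integral_exp_neg_abs: "(\<integral>\<^sup>+x. ennreal (exp (- \<bar>x\<bar>)) \<partial>lborel) = 2"
proof -
  have half: "(\<integral>\<^sup>+x. ennreal (exp (- x)) * indicator {0..} x \<partial>lborel) = 1"
  proof -
    have "((\<lambda>x::real. - exp (- x)) \<longlongrightarrow> - 0) at_top"
      by (intro tendsto_minus filterlim_compose[OF exp_at_bot] filterlim_uminus_at_bot_at_top)
    then have "(\<integral>\<^sup>+x. ennreal (exp (- x)) * indicator {0..} x \<partial>lborel) = ennreal (0 - (- exp (- 0)))"
      by (intro nn_integral_FTC_atLeast) (auto intro!: derivative_eq_intros)
    then show ?thesis by simp
  qed
  have half': "(\<integral>\<^sup>+x. ennreal (exp x) * indicator {..0} x \<partial>lborel) = 1"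
    using half by (subst nn_integral_real_affine[where c="-1" and t=0])
      (auto simp: indicator_def cong: nn_integral_cong)
  have "(\<integral>\<^sup>+x. ennreal (exp (- \<bar>x\<bar>)) \<partial>lborel)
      = (\<integral>\<^sup>+x. ennreal (exp (- x)) * indicator {0..} x + ennreal (exp x) * indicator {..0} x \<partial>lborel)"
  proof (rule nn_integral_cong_AE)
    have "AE x in lborel. x \<noteq> (0::real)" by (rule AE_lborel_singleton)
    then show "AE x in lborel. ennreal (exp (- \<bar>x\<bar>))
        = ennreal (exp (- x)) * indicator {0..} x + ennreal (exp x) * indicator {..0} x"
      by eventually_elim (auto simp: indicator_def)
  qed
  also have "\<dots> = 2"
    by (subst nn_integral_add) (auto simp: half half')
  finally show ?thesis .
qed

lemma integrable_exp_neg_abs: "integrable lborel (\<lambda>x::real. exp (- \<bar>x\<bar>))"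
  by (rule integrableI_bounded) (auto simp: nn_integral_exp_neg_abs)

text \<open>Completing the square in |x| leaves a constant times
  \<open>exp (- \<bar>x\<bar>)\<close>. The linear term is there to absorb the polynomial and
  exponential factors that appear when the Airy integrand is differentiated.\<close>

lemma integrable_gaussian:
  fixes a c :: real
  assumes "c > 0"
  shows "integrable lborel (\<lambda>x. exp (- c * x\<^sup>2 + a * \<bar>x\<bar>))"
proof (rule Bochner_Integration.integrable_bound)
  show "integrable lborel (\<lambda>x::real. exp ((a + 1)\<^sup>2 / (4 * c)) * exp (- \<bar>x\<bar>))"
    using integrable_exp_neg_abs by (rule integrable_mult_right)
  have "- c * x\<^sup>2 + a * \<bar>x\<bar> \<le> (a + 1)\<^sup>2 / (4 * c) - \<bar>x\<bar>" for x
  proof -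
    \<comment> \<open>The claim multiplied by 4c, with |x| moved to the left, is exactly the
      nonnegativity of this square.\<close>
    have "0 \<le> (2 * c * \<bar>x\<bar> - (a + 1))\<^sup>2" by simp
    then have "4 * c * (a * \<bar>x\<bar> + \<bar>x\<bar> - c * x\<^sup>2) \<le> (a + 1)\<^sup>2"
      by (simp add: power2_eq_square algebra_simps)
    with assms show ?thesis by (simp add: field_simps)
  qed
  then show "AE x in lborel. norm (exp (- c * x\<^sup>2 + a * \<bar>x\<bar>))
      \<le> norm (exp ((a + 1)\<^sup>2 / (4 * c)) * exp (- \<bar>x\<bar>))"
    by (intro AE_I2) (simp add: exp_add[symmetric])
qed measurable

text \<open>Differentiation under the integral sign through the second-order Taylor remainder of
  exp: for |h| \<le> 1 it is dominated by h squared times the function in the last hypothesis, so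
  the difference quotient converges with an explicit rate. The base point 0 suffices for the Airy
  moments, since changing s by h multiplies their integrand by an exponential that is linear in
  h.\<close>

lemma has_vector_derivative_exp_integral:
  fixes f z :: "real \<Rightarrow> complex"
  assumes [measurable]: "z \<in> borel_measurable borel"
    and f: "integrable lborel f"
    and fz: "integrable lborel (\<lambda>m. f m * z m)"
    and dom: "integrable lborel (\<lambda>m. norm (f m) * (norm (z m))\<^sup>2 * exp (norm (z m)))"
  shows "((\<lambda>h. \<integral>m. f m * exp (of_real h * z m) \<partial>lborel)
           has_vector_derivative (\<integral>m. f m * z m \<partial>lborel)) (at 0)"
proof -
  have [measurable]: "f \<in> borel_measurable borel"
    using f by (simp add: borel_measurable_integrable)
  define R where "R h m = f m * (exp (of_real h * z m) - (1 + of_real h * z m))" for h m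
  define M where "M = (\<integral>m. norm (f m) * (norm (z m))\<^sup>2 * exp (norm (z m)) \<partial>lborel)"
  have R_le: "norm (R h m) \<le> h\<^sup>2 * (norm (f m) * (norm (z m))\<^sup>2 * exp (norm (z m)))"
    if "\<bar>h\<bar> \<le> 1" for h m
  proof -
    let ?w = "of_real h * z m"
    have "norm (exp ?w - (\<Sum>k\<le>1. ?w ^ k / fact k)) \<le> exp \<bar>Re ?w\<bar> * norm ?w ^ Suc 1 / fact 1"
      by (rule Taylor_exp)
    also have "\<bar>Re ?w\<bar> \<le> norm (z m)"
      using that abs_Re_le_cmod[of "z m"] mult_mono[of "\<bar>h\<bar>" 1 "\<bar>Re (z m)\<bar>" "norm (z m)"]
      by (simp add: abs_mult)
    finally have "norm (exp ?w - (1 + ?w)) \<le> exp (norm (z m)) * (norm ?w)\<^sup>2"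
      by (simp add: power2_eq_square mult_right_mono)
    then have "norm (f m) * norm (exp ?w - (1 + ?w)) \<le> norm (f m) * (exp (norm (z m)) * (norm ?w)\<^sup>2)"
      by (rule mult_left_mono) simp
    then show ?thesis
      by (simp add: R_def norm_mult power_mult_distrib mult_ac)
  qed
  have R_int: "integrable lborel (R h)" if "\<bar>h\<bar> \<le> 1" for h
  proof (rule Bochner_Integration.integrable_bound)
    show "integrable lborel (\<lambda>m. h\<^sup>2 * (norm (f m) * (norm (z m))\<^sup>2 * exp (norm (z m))))"
      using dom by (rule integrable_mult_right)
    show "R h \<in> borel_measurable lborel" unfolding R_def[abs_def] by measurable
    show "AE m in lborel. norm (R h m)
        \<le> norm (h\<^sup>2 * (norm (f m) * (norm (z m))\<^sup>2 * exp (norm (z m))))"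
      using R_le[OF that] by (intro AE_I2) (simp add: abs_mult)
  qed
  have R_bound: "norm (\<integral>m. R h m \<partial>lborel) \<le> h\<^sup>2 * M" if "\<bar>h\<bar> \<le> 1" for h
  proof -
    have "norm (\<integral>m. R h m \<partial>lborel)
        \<le> (\<integral>m. h\<^sup>2 * (norm (f m) * (norm (z m))\<^sup>2 * exp (norm (z m))) \<partial>lborel)"
      by (rule Bochner_Integration.integral_norm_bound_integral[OF R_int[OF that] integrable_mult_right[OF dom] R_le[OF that]])
    then show ?thesis by (simp add: M_def)
  qed
  have expand: "(\<integral>m. f m * exp (of_real h * z m) \<partial>lborel)
      = (\<integral>m. f m \<partial>lborel) + of_real h * (\<integral>m. f m * z m \<partial>lborel) + (\<integral>m. R h m \<partial>lborel)"
    if "\<bar>h\<bar> \<le> 1" for h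
  proof -
    have "(\<integral>m. f m * exp (of_real h * z m) \<partial>lborel)
        = (\<integral>m. (f m + of_real h * (f m * z m)) + R h m \<partial>lborel)"
      by (intro Bochner_Integration.integral_cong) (auto simp: R_def algebra_simps)
    also have "\<dots> = (\<integral>m. f m + of_real h * (f m * z m) \<partial>lborel) + (\<integral>m. R h m \<partial>lborel)"
      using f fz R_int[OF that] by (intro Bochner_Integration.integral_add) auto
    also have "(\<integral>m. f m + of_real h * (f m * z m) \<partial>lborel)
        = (\<integral>m. f m \<partial>lborel) + of_real h * (\<integral>m. f m * z m \<partial>lborel)"
      using f fz by (subst Bochner_Integration.integral_add) auto
    finally show ?thesis .
  qed
  let ?I = "\<lambda>h::real. \<integral>m. f m * exp (of_real h * z m) \<partial>lborel"
  let ?D = "\<integral>m. f m * z m \<partial>lborel"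
  have "((\<lambda>h. norm (?I (0 + h) - ?I 0 - h *\<^sub>R ?D) / norm h) \<longlongrightarrow> 0) (at 0)"
  proof (rule Lim_null_comparison)
    show "((\<lambda>h::real. \<bar>h\<bar> * M) \<longlongrightarrow> 0) (at 0)"
      by (rule tendsto_eq_intros | simp)+
    have "norm (norm (?I (0 + h) - ?I 0 - h *\<^sub>R ?D) / norm h) \<le> \<bar>h\<bar> * M" if "\<bar>h\<bar> \<le> 1" "h \<noteq> 0" for h
    proof -
      have "norm (?I (0 + h) - ?I 0 - h *\<^sub>R ?D) \<le> h\<^sup>2 * M"
        using expand[OF that(1)] R_bound[OF that(1)] by (simp add: scaleR_conv_of_real)
      then have "norm (norm (?I (0 + h) - ?I 0 - h *\<^sub>R ?D) / norm h) \<le> h\<^sup>2 * M / \<bar>h\<bar>"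
        using that(2) by (simp add: divide_simps)
      also have "\<dots> = \<bar>h\<bar> * M" using that(2) by (simp add: power2_eq_square abs_if)
      finally show ?thesis .
    qed
    moreover have "\<forall>\<^sub>F h::real in at 0. \<bar>h\<bar> \<le> 1 \<and> h \<noteq> 0"
      unfolding eventually_at by (rule exI[of _ 1]) auto
    ultimately show "\<forall>\<^sub>F h in at 0. norm (norm (?I (0 + h) - ?I 0 - h *\<^sub>R ?D) / norm h) \<le> \<bar>h\<bar> * M"
      by (auto elim: eventually_mono)
  qed
  then show ?thesis
    unfolding has_vector_derivative_def has_derivative_at
    by (intro conjI bounded_linear_scaleR_left)
qed

section \<open>The Airy function\<close>

text \<open>The classical Airy integrand on the line of imaginary part 1, parametrised by the real
  part m. There it decays like \<open>exp (- m\<^sup>2)\<close>, whereas on the real line it has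
  modulus 1. Without the usual factor 1/(2 pi), \<open>airy\<close> is 2 pi times the Airy function
  Ai.\<close>

definition airy_integrand :: "real \<Rightarrow> real \<Rightarrow> complex" where
  "airy_integrand s m = exp (\<i> * ((of_real m + \<i>) ^ 3 / 3 + of_real s * (of_real m + \<i>)))"

text \<open>Up to the factor \<open>\<i> ^ k\<close>, the k-th derivative of
  \<open>airy\<close>.\<close>

definition airy_moment :: "nat \<Rightarrow> real \<Rightarrow> complex" where
  "airy_moment k s = (\<integral>m. (of_real m + \<i>) ^ k * airy_integrand s m \<partial>lborel)"

abbreviation airy :: "real \<Rightarrow> complex" where
  "airy \<equiv> airy_moment 0"

section \<open>Integrability and differentiation of the moments\<close>

lemma norm_airy_integrand: "norm (airy_integrand s m) = exp (1 / 3 - s) * exp (- m\<^sup>2)"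
  by (simp add: airy_integrand_def power3_eq_cube power2_eq_square algebra_simps flip: exp_add)
    (simp add: field_simps)

lemma airy_integrand_measurable [measurable]: "airy_integrand s \<in> borel_measurable borel"
  unfolding airy_integrand_def[abs_def] by measurable

lemma norm_of_real_plus_i_le: "norm (of_real m + \<i>) \<le> \<bar>m\<bar> + 1"
  using norm_triangle_ineq[of "of_real m" \<i>] by simp

text \<open>A single term of the exponential series is at most its sum, so all powers are controlled
  by one exponential.\<close>

lemma norm_of_real_plus_i_power_le: "norm ((of_real m + \<i>) ^ k) \<le> fact k * exp (\<bar>m\<bar> + 1)"
proof -
  let ?x = "\<bar>m\<bar> + 1"
  have "?x ^ k / fact k \<le> (\<Sum>n\<le>k. ?x ^ n / fact n)"
    by (rule member_le_sum) auto
  also have "\<dots> \<le> exp ?x"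
    using summable_exp_generic[of ?x]
    by (auto simp: exp_def divide_inverse mult.commute intro!: sum_le_suminf)
  finally have "?x ^ k \<le> fact k * exp ?x"
    by (simp add: field_simps)
  moreover have "norm ((of_real m + \<i>) ^ k) \<le> ?x ^ k"
    unfolding norm_power by (intro power_mono norm_of_real_plus_i_le) simp
  ultimately show ?thesis by linarith
qed

text \<open>The extra exponential factor supplies the domination hypothesis of
  \<open>has_vector_derivative_exp_integral\<close>; Gaussian decay absorbs it.\<close>

lemma integrable_airy_moment_exp:
  "integrable lborel (\<lambda>m. norm ((of_real m + \<i>) ^ k * airy_integrand s m) * exp (norm (of_real m + \<i>)))"
proof (rule Bochner_Integration.integrable_bound)
  \<comment> \<open>The exponent 7/3 - s collects 1/3 - s from the integrand and one unit from each
    of two factors \<open>exp (\<bar>m\<bar> + 1)\<close>.\<close>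
  show "integrable lborel (\<lambda>m. (fact k * exp (7 / 3 - s)) * exp (- 1 * m\<^sup>2 + 2 * \<bar>m\<bar>))"
    by (intro integrable_mult_right integrable_gaussian) simp
  have "norm ((of_real m + \<i>) ^ k * airy_integrand s m) * exp (norm (of_real m + \<i>))
      \<le> fact k * exp (\<bar>m\<bar> + 1) * (exp (1 / 3 - s) * exp (- m\<^sup>2)) * exp (\<bar>m\<bar> + 1)" for m
    unfolding norm_mult norm_airy_integrand
    by (intro mult_mono norm_of_real_plus_i_power_le) (auto simp: norm_of_real_plus_i_le)
  also have "\<dots> m = (fact k * exp (7 / 3 - s)) * exp (- 1 * m\<^sup>2 + 2 * \<bar>m\<bar>)" for m
    by (simp flip: exp_add)
  finally show "AE m in lborel. norm (norm ((of_real m + \<i>) ^ k * airy_integrand s m) * exp (norm (of_real m + \<i>)))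
      \<le> norm ((fact k * exp (7 / 3 - s)) * exp (- 1 * m\<^sup>2 + 2 * \<bar>m\<bar>))"
    by (intro AE_I2) simp
qed measurable

lemma integrable_airy_moment:
  "integrable lborel (\<lambda>m. (of_real m + \<i>) ^ k * airy_integrand s m)"
proof (rule Bochner_Integration.integrable_bound[OF integrable_airy_moment_exp])
  show "AE m in lborel. norm ((of_real m + \<i>) ^ k * airy_integrand s m)
      \<le> norm (norm ((of_real m + \<i>) ^ k * airy_integrand s m) * exp (norm (of_real m + \<i>)))"
    by (intro AE_I2) (simp add: mult_le_cancel_left1)
qed measurable

lemma has_vector_derivative_airy_moment:
  "(airy_moment k has_vector_derivative \<i> * airy_moment (Suc k) s) (at s)"
proof -
  let ?z = "\<lambda>m. \<i> * (of_real m + \<i>)"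
  let ?f = "\<lambda>m. (of_real m + \<i>) ^ k * airy_integrand s m"
  have fz: "?f m * ?z m = \<i> * ((of_real m + \<i>) ^ Suc k * airy_integrand s m)" for m
    by (simp add: algebra_simps)
  have "((\<lambda>h. \<integral>m. ?f m * exp (of_real h * ?z m) \<partial>lborel)
          has_vector_derivative (\<integral>m. ?f m * ?z m \<partial>lborel)) (at 0)"
  proof (rule has_vector_derivative_exp_integral)
    show "integrable lborel (\<lambda>m. ?f m * ?z m)"
      unfolding fz using integrable_airy_moment[of "Suc k" s] by (rule integrable_mult_right)
    have "norm (?f m) * (norm (?z m))\<^sup>2 * exp (norm (?z m))
        = norm ((of_real m + \<i>) ^ (k + 2) * airy_integrand s m) * exp (norm (of_real m + \<i>))" for m
      by (simp add: norm_mult norm_power power_add power2_eq_square mult_ac)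
    then show "integrable lborel (\<lambda>m. norm (?f m) * (norm (?z m))\<^sup>2 * exp (norm (?z m)))"
      using integrable_airy_moment_exp[of "k + 2" s] by simp
  qed (use integrable_airy_moment in auto)
  moreover have "?f m * exp (of_real h * ?z m) = (of_real m + \<i>) ^ k * airy_integrand (s + h) m" for h m
    by (simp add: airy_integrand_def algebra_simps flip: exp_add)
  ultimately have "((\<lambda>h. airy_moment k (s + h)) has_vector_derivative \<i> * airy_moment (Suc k) s) (at 0)"
    by (simp add: airy_moment_def fz del: power_Suc)
  then show ?thesis
    unfolding has_vector_derivative_def has_derivative_at by simp
qed

lemma continuous_on_airy: "continuous_on S airy"
  using has_vector_derivative_airy_moment
  by (auto intro!: continuous_at_imp_continuous_on has_vector_derivative_continuous)

lemma airy_measurable [measurable]: "airy \<in> borel_measurable borel"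
  using continuous_on_airy by (rule borel_measurable_continuous_onI)

text \<open>The fundamental theorem of calculus on [-n, n], with dominated convergence as n grows.
  It is used both for integration by parts in the Airy equation and for the contour shift.\<close>

lemma integral_derivative_eq_0:
  fixes E :: "real \<Rightarrow> complex"
  assumes deriv: "\<And>m. (E has_vector_derivative E' m) (at m)"
    and cont: "continuous_on UNIV E'" and int: "integrable lborel E'"
    and top: "(E \<longlongrightarrow> 0) at_top" and bot: "(E \<longlongrightarrow> 0) at_bot"
  shows "(\<integral>m. E' m \<partial>lborel) = 0"
proof (rule LIMSEQ_unique)
  have meas: "E' \<in> borel_measurable borel"
    using cont by (rule borel_measurable_continuous_onI)
  show "(\<lambda>n. \<integral>m. indicator {- real n..real n} m *\<^sub>R E' m \<partial>lborel) \<longlonglongrightarrow> (\<integral>m. E' m \<partial>lborel)"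
  proof (rule integral_dominated_convergence)
    show "integrable lborel (\<lambda>m. norm (E' m))" using int by simp
    have "(\<lambda>n. indicator {- real n..real n} m *\<^sub>R E' m) \<longlonglongrightarrow> E' m" for m
    proof (rule tendsto_eventually)
      obtain N where "\<bar>m\<bar> \<le> real N" using real_arch_simple by blast
      then show "\<forall>\<^sub>F n in sequentially. indicator {- real n..real n} m *\<^sub>R E' m = E' m"
        by (auto simp: eventually_sequentially indicator_def intro!: exI[of _ N])
    qed
    then show "AE m in lborel. (\<lambda>n. indicator {- real n..real n} m *\<^sub>R E' m) \<longlonglongrightarrow> E' m" by simp
  qed (use meas in \<open>auto simp: indicator_def\<close>)
  have "(\<integral>m. indicator {- real n..real n} m *\<^sub>R E' m \<partial>lborel) = E (real n) - E (- real n)" for n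
    by (rule integral_FTC_atLeastAtMost)
      (auto intro: has_vector_derivative_at_within deriv continuous_on_subset[OF cont])
  moreover have "(\<lambda>n. E (real n) - E (- real n)) \<longlonglongrightarrow> 0 - 0"
    by (intro tendsto_diff filterlim_compose[OF top] filterlim_compose[OF bot]
        filterlim_real_sequentially filterlim_compose[OF filterlim_uminus_at_bot_at_top])
  ultimately show "(\<lambda>n. \<integral>m. indicator {- real n..real n} m *\<^sub>R E' m \<partial>lborel) \<longlonglongrightarrow> 0" by simp
qed

lemma exp_minus_square_tendsto_0:
  shows "((\<lambda>m::real. exp (- m\<^sup>2)) \<longlongrightarrow> 0) at_top" "((\<lambda>m::real. exp (- m\<^sup>2)) \<longlongrightarrow> 0) at_bot"
  by (intro filterlim_compose[OF exp_at_bot] filterlim_compose[OF filterlim_uminus_at_bot_at_top]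
      filterlim_pow_at_top filterlim_ident filterlim_pow_at_bot_even; simp)+

text \<open>The integrand is the exponential of a cubic phase, so its derivative in m brings down
  i((m + i)^2 + s), and the integral of this total derivative vanishes. As the second moment is
  minus the second derivative, this is the Airy equation u'' = s u.\<close>

lemma airy_ode: "airy_moment 2 s = - of_real s * airy s"
proof -
  let ?E' = "\<lambda>m. \<i> * ((of_real m + \<i>)\<^sup>2 + of_real s) * airy_integrand s m"
  have split: "?E' m = \<i> * ((of_real m + \<i>)\<^sup>2 * airy_integrand s m)
      + \<i> * of_real s * ((of_real m + \<i>) ^ 0 * airy_integrand s m)" for m
    by (simp add: algebra_simps)
  have lim: "(airy_integrand s \<longlongrightarrow> 0) F" if "((\<lambda>m. exp (- m\<^sup>2)) \<longlongrightarrow> 0) F" for F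
    using tendsto_mult_right_zero[OF that, of "exp (1 / 3 - s)"]
    by (auto intro: tendsto_norm_zero_cancel simp: norm_airy_integrand)
  have "(\<integral>m. ?E' m \<partial>lborel) = 0"
  proof (rule integral_derivative_eq_0)
    show "(airy_integrand s has_vector_derivative ?E' m) (at m)" for m
    proof -
      have "((\<lambda>w. \<i> * ((w + \<i>) ^ 3 / 3 + of_real s * (w + \<i>)))
          has_field_derivative \<i> * ((of_real m + \<i>)\<^sup>2 + of_real s)) (at (of_real m))"
        by (auto intro!: derivative_eq_intros)
      from DERIV_chain2[OF DERIV_exp this]
      have "((\<lambda>w. exp (\<i> * ((w + \<i>) ^ 3 / 3 + of_real s * (w + \<i>))))
          has_field_derivative ?E' m) (at (of_real m))"
        by (simp add: airy_integrand_def mult_ac)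
      then have "(((\<lambda>w. exp (\<i> * ((w + \<i>) ^ 3 / 3 + of_real s * (w + \<i>)))) \<circ> of_real)
          has_vector_derivative of_real 1 * ?E' m) (at m)"
        by (intro field_vector_diff_chain_at) (auto intro!: derivative_eq_intros)
      then show ?thesis by (simp add: airy_integrand_def[abs_def] comp_def)
    qed
    show "continuous_on UNIV ?E'" unfolding airy_integrand_def by (intro continuous_intros) simp
    show "integrable lborel ?E'"
      unfolding split by (intro Bochner_Integration.integrable_add integrable_mult_right integrable_airy_moment)
  qed (rule lim exp_minus_square_tendsto_0)+
  also have "(\<integral>m. ?E' m \<partial>lborel) = \<i> * airy_moment 2 s + \<i> * of_real s * airy s"
    unfolding split airy_moment_def
    by (subst Bochner_Integration.integral_add)
      ((rule integrable_mult_right, rule integrable_airy_moment)+, simp)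
  finally have "\<i> * (airy_moment 2 s + of_real s * airy s) = 0" by (simp add: algebra_simps)
  then show ?thesis by (simp add: eq_neg_iff_add_eq_0)
qed

text \<open>Absolute values on the line of imaginary part 1. The true decay is faster, but a simple
  exponential suffices for the convolution.\<close>

lemma norm_airy_le_exp: "norm (airy s) \<le> exp (1 / 3) * (\<integral>m. exp (- (m::real)\<^sup>2) \<partial>lborel) * exp (- s)"
proof -
  have "norm (airy s) \<le> (\<integral>m. norm (airy_integrand s m) \<partial>lborel)"
    by (simp add: airy_moment_def)
  also have "\<dots> = exp (1 / 3) * (\<integral>m. exp (- (m::real)\<^sup>2) \<partial>lborel) * exp (- s)"
  proof -
    have "exp (1 / 3 - s) = exp (1 / 3) * exp (- s)" by (simp flip: exp_add)
    then show ?thesis by (simp add: norm_airy_integrand)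
  qed
  finally show ?thesis .
qed

text \<open>The function \<open>E\<close> in the proof is the WKB energy for \<open>u'' = s u\<close> in the variable
  \<open>q = sqrt (- s)\<close>; its cross term makes the logarithmic derivative integrable at infinity.\<close>

lemma airy_ode_decay:
  fixes u v :: "real \<Rightarrow> real"
  assumes u: "\<And>s. (u has_real_derivative v s) (at s)"
    and v: "\<And>s. (v has_real_derivative s * u s) (at s)"
  obtains C where "\<And>q. q \<ge> 1 \<Longrightarrow> q * (u (- q\<^sup>2))\<^sup>2 \<le> C"
proof
  define a where "a q = u (- q\<^sup>2)" for q
  define b where "b q = v (- q\<^sup>2)" for q
  define E where "E q = q * (a q)\<^sup>2 + (b q)\<^sup>2 / q - a q * b q / (2 * q ^ 3)" for q
  \<comment> \<open>The derivative of \<open>E\<close> is at most \<open>E q / q ^ 4\<close>, and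
    the added factor has logarithmic derivative \<open>- 1 / q ^ 4\<close>; hence \<open>H\<close>
    is nonincreasing on q \<ge> 1.\<close>
  define H where "H q = E q * exp (1 / (3 * q ^ 3))" for q
  have sq: "((\<lambda>q. - q\<^sup>2) has_real_derivative - 2 * q) (at q)" for q :: real
    by (auto intro!: derivative_eq_intros)
  have a': "(a has_real_derivative - 2 * q * b q) (at q)" for q
    using DERIV_chain2[OF u sq] unfolding a_def[abs_def] b_def by (simp add: mult_ac)
  have b': "(b has_real_derivative 2 * q ^ 3 * a q) (at q)" for q
    using DERIV_chain2[OF v sq] unfolding b_def[abs_def] a_def
    by (simp add: power2_eq_square power3_eq_cube mult_ac)
  have E': "(E has_real_derivative 3 * a q * b q / (2 * q ^ 4)) (at q)" if "q \<ge> 1" for q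
  proof -
    have q: "q \<noteq> 0" using that by simp
    have "((\<lambda>q. q * (a q)\<^sup>2) has_real_derivative (a q)\<^sup>2 - 4 * q\<^sup>2 * a q * b q) (at q)"
      using DERIV_mult[OF DERIV_ident DERIV_power[OF a'[of q], where n=2]]
      by (simp add: power2_eq_square algebra_simps)
    moreover have "((\<lambda>q. (b q)\<^sup>2 / q) has_real_derivative 4 * q\<^sup>2 * a q * b q - (b q)\<^sup>2 / q\<^sup>2) (at q)"
      using DERIV_divide[OF DERIV_power[OF b'[of q], where n=2] DERIV_ident q]
      by (elim DERIV_cong) (use q in \<open>simp add: field_simps eval_nat_numeral\<close>)
    moreover have "((\<lambda>q. a q * b q / (2 * q ^ 3)) has_real_derivative
        (a q)\<^sup>2 - (b q)\<^sup>2 / q\<^sup>2 - 3 * a q * b q / (2 * q ^ 4)) (at q)"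
    proof (rule DERIV_cong)
      have "((\<lambda>q. 2 * q ^ 3) has_real_derivative 6 * q\<^sup>2) (at q)"
        by (auto intro!: derivative_eq_intros)
      from DERIV_divide[OF DERIV_mult[OF a'[of q] b'[of q]] this] q
      show "((\<lambda>q. a q * b q / (2 * q ^ 3)) has_real_derivative
          (((- 2 * q * b q) * b q + (2 * q ^ 3 * a q) * a q) * (2 * q ^ 3) - a q * b q * (6 * q\<^sup>2))
            / ((2 * q ^ 3) * (2 * q ^ 3))) (at q)"
        by simp
      show "(((- 2 * q * b q) * b q + (2 * q ^ 3 * a q) * a q) * (2 * q ^ 3) - a q * b q * (6 * q\<^sup>2))
            / ((2 * q ^ 3) * (2 * q ^ 3)) = (a q)\<^sup>2 - (b q)\<^sup>2 / q\<^sup>2 - 3 * a q * b q / (2 * q ^ 4)"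
        using q by (simp add: field_simps eval_nat_numeral)
    qed
    ultimately have "(E has_real_derivative ((a q)\<^sup>2 - 4 * q\<^sup>2 * a q * b q
        + (4 * q\<^sup>2 * a q * b q - (b q)\<^sup>2 / q\<^sup>2))
        - ((a q)\<^sup>2 - (b q)\<^sup>2 / q\<^sup>2 - 3 * a q * b q / (2 * q ^ 4))) (at q)"
      unfolding E_def[abs_def] by (intro DERIV_diff DERIV_add)
    then show ?thesis by simp
  qed
  have H': "(H has_real_derivative
      (3 * a q * b q / (2 * q ^ 4) - E q / q ^ 4) * exp (1 / (3 * q ^ 3))) (at q)" if "q \<ge> 1" for q
  proof -
    have q: "q \<noteq> 0" using that by simp
    have d: "((\<lambda>q. 3 * q ^ 3) has_real_derivative 9 * q\<^sup>2) (at q)"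
      by (auto intro!: derivative_eq_intros)
    have "((\<lambda>q. 1 / (3 * q ^ 3)) has_real_derivative - 1 / q ^ 4) (at q)"
      using q by (intro DERIV_cong[OF DERIV_divide[OF DERIV_const[of 1] d]]) (simp_all add: field_simps eval_nat_numeral)
    from DERIV_mult[OF E'[OF that] DERIV_chain2[OF DERIV_exp this]]
    show ?thesis unfolding H_def[abs_def] by (rule DERIV_cong) (simp add: algebra_simps)
  qed
  have ab: "2 * \<bar>a q * b q\<bar> \<le> q * (a q)\<^sup>2 + (b q)\<^sup>2 / q" if "q \<ge> 1" for q
  proof -
    have "0 \<le> (q * \<bar>a q\<bar> - \<bar>b q\<bar>)\<^sup>2 / q" using that by simp
    also have "\<dots> = q * (a q)\<^sup>2 + (b q)\<^sup>2 / q - 2 * \<bar>a q * b q\<bar>"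
      using that by (simp add: power2_eq_square divide_simps abs_mult) (simp add: algebra_simps)
    finally show ?thesis by simp
  qed
  have cross: "\<bar>a q * b q / (2 * q ^ 3)\<bar> \<le> \<bar>a q * b q\<bar> / 2" if "q \<ge> 1" for q
  proof -
    have "1 \<le> q ^ 3" using that by (rule one_le_power)
    then have "\<bar>a q * b q\<bar> / (2 * q ^ 3) \<le> \<bar>a q * b q\<bar> / (2 * 1)"
      using that by (intro divide_left_mono) auto
    then show ?thesis using that by (simp add: abs_mult)
  qed
  \<comment> \<open>By \<open>ab\<close> and \<open>cross\<close>, the cross term is at most a
    quarter of the sum of the two squares, so \<open>E\<close> keeps at least 3/4 of that sum, which
    in turn is at least 3/2 of |a b|.\<close>
  have E_ge: "3 / 2 * \<bar>a q * b q\<bar> \<le> E q" "3 / 4 * (q * (a q)\<^sup>2) \<le> E q" "0 \<le> E q" if "q \<ge> 1" for q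
  proof -
    have "0 \<le> (b q)\<^sup>2 / q" using that by simp
    then show "3 / 2 * \<bar>a q * b q\<bar> \<le> E q" "3 / 4 * (q * (a q)\<^sup>2) \<le> E q" "0 \<le> E q"
      using ab[OF that] cross[OF that] abs_ge_zero[of "a q * b q"]
      unfolding E_def abs_le_iff by linarith+
  qed
  show "q * (u (- q\<^sup>2))\<^sup>2 \<le> 4 / 3 * H 1" if "q \<ge> 1" for q
  proof -
    have "H q \<le> H 1"
    proof (rule DERIV_nonpos_imp_nonincreasing[OF that])
      fix r :: real assume r: "1 \<le> r" "r \<le> q"
      have "3 * a r * b r / (2 * r ^ 4) - E r / r ^ 4 = (3 / 2 * (a r * b r) - E r) / r ^ 4"
        using r by (simp add: field_simps)
      also have "\<dots> \<le> 0"
        using E_ge(1)[OF r(1)] r by (intro divide_nonpos_pos) auto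
      finally show "\<exists>y. DERIV H r :> y \<and> y \<le> 0"
        using H'[OF r(1)] by (intro exI conjI) (auto intro: mult_nonpos_nonneg)
    qed
    moreover have "E q * 1 \<le> H q"
      unfolding H_def using that E_ge(3)[OF that] by (intro mult_left_mono) auto
    ultimately show ?thesis using E_ge(2)[OF that] by (simp add: a_def)
  qed
qed

text \<open>The real and imaginary parts both solve u'' = s u, so the energy estimate applies to
  each with q = sqrt(-s) and gives the power -1/4 for s \<le> -1. The exponential bound covers the
  remaining range.\<close>

lemma airy_bounds:
  obtains C where "C > 0" "\<And>s. norm (airy s) \<le> C * exp (- s)"
    "\<And>s. s \<le> 0 \<Longrightarrow> norm (airy s) \<le> C * (1 - s) powr (- 1 / 4)"
    "\<And>s. norm (airy s) \<le> C"
proof -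
  define D where "D = exp (1 / 3) * (\<integral>m. exp (- (m::real)\<^sup>2) \<partial>lborel)"
  have D: "norm (airy s) \<le> D * exp (- s)" for s
    using norm_airy_le_exp by (simp add: D_def)
  have D0: "0 \<le> D" unfolding D_def by (intro mult_nonneg_nonneg integral_nonneg) auto
  have v1: "(airy_moment 0 has_vector_derivative \<i> * airy_moment 1 s) (at s)" for s
    using has_vector_derivative_airy_moment[of 0 s] by simp
  have v2: "((\<lambda>s. \<i> * airy_moment 1 s) has_vector_derivative of_real s * airy s) (at s)" for s
  proof -
    have "((\<lambda>s. \<i> * airy_moment 1 s) has_vector_derivative \<i> * (\<i> * airy_moment (Suc 1) s)) (at s)"
      by (intro has_vector_derivative_mult_right has_vector_derivative_airy_moment)
    moreover have "\<i> * (\<i> * airy_moment (Suc 1) s) = of_real s * airy s"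
      using airy_ode[of s] by (simp add: numeral_2_eq_2 algebra_simps)
    ultimately show ?thesis by simp
  qed
  have "((\<lambda>s. Re (airy s)) has_real_derivative Re (\<i> * airy_moment 1 s)) (at s)"
       "((\<lambda>s. Im (airy s)) has_real_derivative Im (\<i> * airy_moment 1 s)) (at s)" for s
    using bounded_linear.has_vector_derivative[OF bounded_linear_Re v1[of s]]
      bounded_linear.has_vector_derivative[OF bounded_linear_Im v1[of s]]
    by (simp_all add: has_real_derivative_iff_has_vector_derivative)
  moreover have "((\<lambda>s. Re (\<i> * airy_moment 1 s)) has_real_derivative s * Re (airy s)) (at s)"
       "((\<lambda>s. Im (\<i> * airy_moment 1 s)) has_real_derivative s * Im (airy s)) (at s)" for s
    using bounded_linear.has_vector_derivative[OF bounded_linear_Re v2[of s]]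
      bounded_linear.has_vector_derivative[OF bounded_linear_Im v2[of s]]
    by (simp_all add: has_real_derivative_iff_has_vector_derivative)
  ultimately obtain C1 C2 where C1: "\<And>q. q \<ge> 1 \<Longrightarrow> q * (Re (airy (- q\<^sup>2)))\<^sup>2 \<le> C1"
    and C2: "\<And>q. q \<ge> 1 \<Longrightarrow> q * (Im (airy (- q\<^sup>2)))\<^sup>2 \<le> C2"
    using airy_ode_decay[of "\<lambda>s. Re (airy s)" "\<lambda>s. Re (\<i> * airy_moment 1 s)"]
      airy_ode_decay[of "\<lambda>s. Im (airy s)" "\<lambda>s. Im (\<i> * airy_moment 1 s)"] by metis
  \<comment> \<open>The factor 2 pays for comparing powers of -s with powers of 1 - s when s \<le>
    -1, and for (1 - s) powr (-1/4) \<ge> 1/2 when -1 < s \<le> 0, where exp (-s) \<le> exp 1. The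
    final 1 ensures positivity.\<close>
  define C where "C = 2 * (sqrt \<bar>C1 + C2\<bar> + D * exp 1) + 1"
  have C_ge: "2 * sqrt \<bar>C1 + C2\<bar> \<le> C" "2 * (D * exp 1) \<le> C" "D \<le> C" "0 < C"
  proof -
    have *: "D * 1 \<le> D * exp 1" using D0 by (intro mult_left_mono) auto
    have r: "0 \<le> sqrt \<bar>C1 + C2\<bar>" by simp
    show "2 * sqrt \<bar>C1 + C2\<bar> \<le> C" unfolding C_def using D0 by simp
    show "2 * (D * exp 1) \<le> C" unfolding C_def using r by (simp add: algebra_simps)
    then show "D \<le> C" using * D0 by simp
    have "0 \<le> D * exp 1" using D0 by simp
    then show "0 < C" unfolding C_def using r D0 by (intro add_nonneg_pos mult_nonneg_nonneg add_nonneg_nonneg) auto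
  qed
  have far: "norm (airy s) \<le> C * (1 - s) powr (- 1 / 4)" if "s \<le> - 1" for s
  proof -
    define q where "q = sqrt (- s)"
    have q: "q \<ge> 1" "q\<^sup>2 = - s" using that by (auto simp: q_def)
    have "q * (norm (airy s))\<^sup>2 \<le> C1 + C2"
      using C1[OF q(1)] C2[OF q(1)] q(2) by (simp add: cmod_power2 algebra_simps)
    then have "(norm (airy s))\<^sup>2 \<le> \<bar>C1 + C2\<bar> / q" using q(1) by (simp add: field_simps)
    then have "norm (airy s) \<le> sqrt (\<bar>C1 + C2\<bar> / q)" by (rule real_le_rsqrt)
    also have "\<dots> = sqrt \<bar>C1 + C2\<bar> * (- s) powr (- 1 / 4)"
      using that by (simp add: q_def real_sqrt_divide powr_half_sqrt[symmetric] powr_powr powr_minus_divide)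
    also have "\<dots> \<le> sqrt \<bar>C1 + C2\<bar> * (2 * (1 - s) powr (- 1 / 4))"
    proof (intro mult_left_mono)
      have "(1 - s) powr (1 / 4) \<le> (2 * (- s)) powr (1 / 4)"
        using that by (intro powr_mono2) auto
      also have "\<dots> = 2 powr (1 / 4) * (- s) powr (1 / 4)"
        by (rule powr_mult)
      also have "(2::real) powr (1 / 4) \<le> 2 powr 1" by (intro powr_mono) auto
      finally have "(1 - s) powr (1 / 4) \<le> 2 * (- s) powr (1 / 4)" by (simp add: mult_right_mono)
      then have "inverse (2 * (- s) powr (1 / 4)) \<le> inverse ((1 - s) powr (1 / 4))"
        using that by (intro le_imp_inverse_le) auto
      then show "(- s) powr (- 1 / 4) \<le> 2 * (1 - s) powr (- 1 / 4)"
        by (simp add: powr_minus)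
    qed simp
    also have "\<dots> \<le> C * (1 - s) powr (- 1 / 4)"
      using mult_right_mono[OF C_ge(1), of "(1 - s) powr (- 1 / 4)"] by (simp add: mult_ac)
    finally show ?thesis .
  qed
  have near: "norm (airy s) \<le> C * (1 - s) powr (- 1 / 4)" if "- 1 < s" "s \<le> 0" for s
  proof -
    have "(1 - s) powr (1 / 4) \<le> 2 powr (1 / 4)" using that by (intro powr_mono2) auto
    also have "\<dots> \<le> 2 powr 1" by (intro powr_mono) auto
    finally have *: "1 / 2 \<le> (1 - s) powr (- 1 / 4)"
      using that by (simp add: powr_minus_divide field_simps)
    have "norm (airy s) \<le> D * exp 1"
      using D[of s] mult_left_mono[OF _ D0, of "exp (- s)" "exp 1"] that by simp
    also have "\<dots> \<le> C * (1 / 2)" using C_ge(2) by simp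
    also have "\<dots> \<le> C * (1 - s) powr (- 1 / 4)" using * C_ge(4) by (intro mult_left_mono) auto
    finally show ?thesis .
  qed
  show ?thesis
  proof (rule that[OF C_ge(4)])
    show exp: "norm (airy s) \<le> C * exp (- s)" for s
      by (rule order_trans[OF D mult_right_mono[OF C_ge(3)]]) simp
    show neg: "norm (airy s) \<le> C * (1 - s) powr (- 1 / 4)" if "s \<le> 0" for s
      using far[of s] near[of s] that by linarith
    show "norm (airy s) \<le> C" for s
    proof (cases "s \<le> 0")
      case True
      have "(1 - s) powr (- 1 / 4) \<le> 1 powr (- 1 / 4)"
        using True by (intro powr_mono2') auto
      then have "C * (1 - s) powr (- 1 / 4) \<le> C * 1"
        using C_ge(4) by (intro mult_left_mono) auto
      with neg[OF True] show ?thesis by simp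
    next
      case False
      then have "C * exp (- s) \<le> C * 1"
        using C_ge(4) by (intro mult_left_mono) auto
      with exp[of s] show ?thesis by simp
    qed
  qed
qed

section \<open>The kernel as a product of Airy functions\<close>

text \<open>With an entire primitive \<open>H\<close> of \<open>h\<close>, the difference of the two
  integrands is the derivative of \<open>E x\<close>, the increment of \<open>H\<close> along the
  vertical segment above x. The mean value bound gives |E x| \<le> \<alpha> g(x), which tends to 0
  at both ends, so the difference integrates to 0.\<close>

lemma integral_shift_contour:
  fixes h :: "complex \<Rightarrow> complex" and \<alpha> :: real
  assumes hol: "h holomorphic_on UNIV" and \<alpha>: "0 \<le> \<alpha>"
    and bound: "\<And>x b. 0 \<le> b \<Longrightarrow> b \<le> \<alpha> \<Longrightarrow> norm (h (of_real x + \<i> * of_real b)) \<le> g x"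
    and g: "integrable lborel g" "(g \<longlongrightarrow> 0) at_top" "(g \<longlongrightarrow> 0) at_bot"
  shows "(\<integral>x. h (of_real x) \<partial>lborel) = (\<integral>x. h (of_real x + \<i> * of_real \<alpha>) \<partial>lborel)"
proof -
  obtain H where H: "(H has_field_derivative h z) (at z)" for z
    using holomorphic_convex_primitive'[of UNIV h] hol by auto
  have cont: "continuous_on A h" for A
    using hol by (auto intro: holomorphic_on_imp_continuous_on holomorphic_on_subset)
  have int: "integrable lborel (\<lambda>x. h (of_real x + \<i> * of_real b))" if "0 \<le> b" "b \<le> \<alpha>" for b
  proof (rule Bochner_Integration.integrable_bound[OF g(1)])
    show "(\<lambda>x. h (of_real x + \<i> * of_real b)) \<in> borel_measurable lborel"
      by (simp, intro borel_measurable_continuous_onI continuous_intros continuous_on_compose2[OF cont]) auto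
    show "AE x in lborel. norm (h (of_real x + \<i> * of_real b)) \<le> norm (g x)"
      using bound[OF that] by (intro AE_I2) (smt (verit) real_norm_def)
  qed
  define E where "E x = H (of_real x + \<i> * of_real \<alpha>) - H (of_real x)" for x :: real
  have E_le: "norm (E x) \<le> g x * \<alpha>" for x
  proof -
    let ?S = "closed_segment (of_real x :: complex) (of_real x + \<i> * of_real \<alpha>)"
    have "norm (E x) \<le> g x * norm (of_real x + \<i> * of_real \<alpha> - (of_real x :: complex))"
      unfolding E_def
    proof (rule field_differentiable_bound[of ?S H h])
      fix z assume "z \<in> ?S"
      then obtain u where u: "0 \<le> u" "u \<le> 1" "z = (1 - u) *\<^sub>R of_real x + u *\<^sub>R (of_real x + \<i> * of_real \<alpha>)"
        by (auto simp: closed_segment_def)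
      have "z = of_real x + \<i> * of_real (u * \<alpha>)"
        by (simp add: u(3) scaleR_conv_of_real algebra_simps)
      moreover have "u * \<alpha> \<le> \<alpha>" using u \<alpha> by (simp add: mult_left_le_one_le)
      ultimately show "norm (h z) \<le> g x" using bound[of "u * \<alpha>" x] u \<alpha> by simp
    qed (auto intro: has_field_derivative_at_within H)
    then show ?thesis using \<alpha> by (simp add: norm_mult)
  qed
  have E_lim: "(E \<longlongrightarrow> 0) F" if "(g \<longlongrightarrow> 0) F" for F
  proof (rule Lim_null_comparison)
    show "((\<lambda>x. g x * \<alpha>) \<longlongrightarrow> 0) F" using that by (rule tendsto_mult_left_zero)
  qed (simp add: E_le)
  have "(\<integral>x. h (of_real x + \<i> * of_real \<alpha>) - h (of_real x) \<partial>lborel) = 0"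
  proof (rule integral_derivative_eq_0)
    have "((H \<circ> (\<lambda>x. of_real x + \<i> * of_real b)) has_vector_derivative 1 * h (of_real x + \<i> * of_real b)) (at x)"
      for x b :: real
      by (intro field_vector_diff_chain_at H) (auto intro!: derivative_eq_intros)
    from has_vector_derivative_diff[OF this[of \<alpha>] this[of 0]]
    show "(E has_vector_derivative h (of_real x + \<i> * of_real \<alpha>) - h (of_real x)) (at x)" for x
      by (simp add: E_def[abs_def] comp_def)
    show "continuous_on UNIV (\<lambda>x. h (of_real x + \<i> * of_real \<alpha>) - h (of_real x))"
      by (intro continuous_intros continuous_on_compose2[OF cont]) auto
    show "integrable lborel (\<lambda>x. h (of_real x + \<i> * of_real \<alpha>) - h (of_real x))"
      using int[of \<alpha>] int[of 0] \<alpha> by auto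
  qed (use g E_lim in auto)
  then show ?thesis
    using int[of \<alpha>] int[of 0] \<alpha> by (subst (asm) Bochner_Integration.integral_diff) auto
qed

section \<open>Moving the first frequency into the upper half plane\<close>

lemma integrable_gaussian_pair:
  assumes "c > 0"
  shows "integrable lborel (\<lambda>(x::real, y::real). exp (- c * (x\<^sup>2 + y\<^sup>2)))"
proof -
  have 1: "integrable lborel (\<lambda>x::real. exp (- c * x\<^sup>2))"
    using integrable_gaussian[OF assms, of 0] by simp
  have split: "exp (- c * (x\<^sup>2 + y\<^sup>2)) = exp (- c * x\<^sup>2) * exp (- c * y\<^sup>2)" for x y :: real
    by (simp add: algebra_simps flip: exp_add)
  have "integrable (lborel \<Otimes>\<^sub>M lborel) (\<lambda>z. exp (- c * (fst z)\<^sup>2) * exp (- c * (snd z)\<^sup>2))"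
    by (rule lborel_pair.Fubini_integrable) (use 1 in \<open>auto simp: abs_mult\<close>)
  then show ?thesis
    by (simp only: lborel_prod split case_prod_beta')
qed

text \<open>The integrand of \<open>Airy_reg\<close>, extended analytically in the first frequency
  while the second stays real. The value 0 is allowed for \<epsilon>.\<close>

definition zk_phase :: "real \<Rightarrow> real \<Rightarrow> real \<Rightarrow> real \<Rightarrow> complex \<Rightarrow> real \<Rightarrow> complex" where
  "zk_phase \<epsilon> x y t z \<eta> = exp (- of_real \<epsilon> * (z\<^sup>2 + (of_real \<eta>)\<^sup>2)
     + \<i> * (of_real t * z ^ 3 + of_real t * z * (of_real \<eta>)\<^sup>2 + of_real x * z + of_real y * of_real \<eta>))"

text \<open>Raising the imaginary part of \<xi> to b alone yields Gaussian damping in both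
  frequencies, with rate 3tb in \<xi> and tb in \<eta>. Thus \<eta> need not be shifted.\<close>

lemma norm_zk_phase: "norm (zk_phase \<epsilon> x y t (of_real \<xi> + \<i> * of_real b) \<eta>)
   = exp (- (\<epsilon> + t * b) * (\<xi>\<^sup>2 + \<eta>\<^sup>2) - 2 * t * b * \<xi>\<^sup>2 + (\<epsilon> * b\<^sup>2 + t * b ^ 3 - x * b))"
  by (simp add: zk_phase_def power3_eq_cube power2_eq_square algebra_simps)

text \<open>The first factor is uniform in b up to \<alpha>, as the contour shift requires, and in
  \<epsilon> up to \<epsilon>', as the limit \<epsilon> to 0 requires.\<close>

lemma norm_zk_phase_le:
  assumes "0 \<le> b" "b \<le> \<alpha>" "0 \<le> t" "0 \<le> \<epsilon>" "\<epsilon> \<le> \<epsilon>'"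
  shows "norm (zk_phase \<epsilon> x y t (of_real \<xi> + \<i> * of_real b) \<eta>)
   \<le> exp (\<epsilon>' * \<alpha>\<^sup>2 + t * \<alpha> ^ 3 + \<bar>x\<bar> * \<alpha>) * exp (- (\<epsilon> + t * b) * (\<xi>\<^sup>2 + \<eta>\<^sup>2))"
proof -
  have "\<epsilon> * b\<^sup>2 \<le> \<epsilon>' * \<alpha>\<^sup>2" "t * b ^ 3 \<le> t * \<alpha> ^ 3"
    using assms by (auto intro!: mult_mono power_mono)
  moreover have "- x * b \<le> \<bar>x\<bar> * \<alpha>" using assms by (intro mult_mono) auto
  moreover have "0 \<le> 2 * t * b * \<xi>\<^sup>2" using assms by simp
  ultimately have "- (\<epsilon> + t * b) * (\<xi>\<^sup>2 + \<eta>\<^sup>2) - 2 * t * b * \<xi>\<^sup>2 + (\<epsilon> * b\<^sup>2 + t * b ^ 3 - x * b)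
      \<le> (\<epsilon>' * \<alpha>\<^sup>2 + t * \<alpha> ^ 3 + \<bar>x\<bar> * \<alpha>) + - (\<epsilon> + t * b) * (\<xi>\<^sup>2 + \<eta>\<^sup>2)"
    by linarith
  then show ?thesis
    unfolding norm_zk_phase exp_add[symmetric] by simp
qed

lemma zk_phase_measurable [measurable]:
  "(\<lambda>z. zk_phase \<epsilon> x y t (of_real (f z) + \<i> * of_real b) (g z)) \<in> borel_measurable M"
  if [measurable]: "f \<in> borel_measurable M" "g \<in> borel_measurable M"
  unfolding zk_phase_def by measurable

lemma zk_phase_pair_measurable [measurable]:
  "(\<lambda>z. zk_phase \<epsilon> x y t (of_real (fst z) + \<i> * of_real b) (c * fst z + d * snd z))
     \<in> borel_measurable (borel :: (real \<times> real) measure)"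
  unfolding borel_prod[symmetric] by measurable

lemma integrable_zk_phase:
  assumes "0 \<le> b" "0 \<le> t" "0 \<le> \<epsilon>" "0 < \<epsilon> + t * b"
  shows "integrable lborel (\<lambda>(\<xi>, \<eta>). zk_phase \<epsilon> x y t (of_real \<xi> + \<i> * of_real b) \<eta>)"
proof (rule Bochner_Integration.integrable_bound)
  show "integrable lborel (\<lambda>z. exp (\<epsilon> * b\<^sup>2 + t * b ^ 3 + \<bar>x\<bar> * b)
      * (case z of (\<xi>, \<eta>) \<Rightarrow> exp (- (\<epsilon> + t * b) * (\<xi>\<^sup>2 + \<eta>\<^sup>2))))"
    by (intro integrable_mult_right integrable_gaussian_pair assms)
  show "(\<lambda>(\<xi>, \<eta>). zk_phase \<epsilon> x y t (of_real \<xi> + \<i> * of_real b) \<eta>) \<in> borel_measurable lborel"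
    using zk_phase_pair_measurable[of \<epsilon> x y t b 0 1] by (simp add: case_prod_beta')
  show "AE z in lborel. norm (case z of (\<xi>, \<eta>) \<Rightarrow> zk_phase \<epsilon> x y t (of_real \<xi> + \<i> * of_real b) \<eta>)
     \<le> norm (exp (\<epsilon> * b\<^sup>2 + t * b ^ 3 + \<bar>x\<bar> * b) * (case z of (\<xi>, \<eta>) \<Rightarrow> exp (- (\<epsilon> + t * b) * (\<xi>\<^sup>2 + \<eta>\<^sup>2))))"
    using norm_zk_phase_le[OF assms(1) order_refl assms(2,3) order_refl]
    by (intro AE_I2) (auto simp: abs_mult)
qed

text \<open>For \<epsilon> > 0 the double integral converges absolutely on the real plane and on the
  shifted one, so Fubini reduces the shift to a one-dimensional one for each fixed \<eta>.\<close>

lemma Airy_reg_shift: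
  assumes "0 < \<epsilon>" "0 < t" "0 \<le> \<alpha>"
  shows "Airy_reg \<epsilon> x y t
    = (\<integral>(\<xi>, \<eta>). zk_phase \<epsilon> x y t (of_real \<xi> + \<i> * of_real \<alpha>) \<eta> \<partial>lborel)"
proof -
  have eq: "complex_of_real (exp (- \<epsilon> * (\<xi>\<^sup>2 + \<eta>\<^sup>2))) *
        exp (\<i> * complex_of_real (t * \<xi> ^ 3 + t * \<xi> * \<eta>\<^sup>2 + x * \<xi> + y * \<eta>))
      = zk_phase \<epsilon> x y t (of_real \<xi>) \<eta>" for \<xi> \<eta>
    unfolding zk_phase_def exp_of_real[symmetric] mult_exp_exp by simp
  have int: "integrable (lborel \<Otimes>\<^sub>M lborel) (\<lambda>(\<xi>, \<eta>). zk_phase \<epsilon> x y t (of_real \<xi> + \<i> * of_real b) \<eta>)"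
    if "0 \<le> b" for b
    unfolding lborel_prod using assms that by (intro integrable_zk_phase) (auto intro: add_pos_nonneg)
  have shift: "(\<integral>\<xi>. zk_phase \<epsilon> x y t (of_real \<xi>) \<eta> \<partial>lborel)
      = (\<integral>\<xi>. zk_phase \<epsilon> x y t (of_real \<xi> + \<i> * of_real \<alpha>) \<eta> \<partial>lborel)" for \<eta>
  proof (rule integral_shift_contour)
    \<comment> \<open>The majorant must also hold at b = 0, so it uses only the damping from
      \<epsilon>.\<close>
    let ?g = "\<lambda>\<xi>. exp (\<epsilon> * \<alpha>\<^sup>2 + t * \<alpha> ^ 3 + \<bar>x\<bar> * \<alpha>) * exp (- \<epsilon> * \<xi>\<^sup>2)"
    show "(\<lambda>z. zk_phase \<epsilon> x y t z \<eta>) holomorphic_on UNIV"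
      unfolding zk_phase_def by (intro holomorphic_intros)
    show "0 \<le> \<alpha>" by fact
    show "norm (zk_phase \<epsilon> x y t (of_real \<xi> + \<i> * of_real b) \<eta>) \<le> ?g \<xi>" if "0 \<le> b" "b \<le> \<alpha>" for \<xi> b
    proof -
      have "0 \<le> t * b * (\<xi>\<^sup>2 + \<eta>\<^sup>2) + \<epsilon> * \<eta>\<^sup>2"
        using assms that by simp
      then have "- (\<epsilon> + t * b) * (\<xi>\<^sup>2 + \<eta>\<^sup>2) \<le> - \<epsilon> * \<xi>\<^sup>2"
        by (simp add: algebra_simps)
      then show ?thesis
        using assms
        by (intro order_trans[OF norm_zk_phase_le[OF that _ _ order_refl] mult_left_mono]) auto
    qed
    show "integrable lborel ?g"
      using integrable_gaussian[of \<epsilon> 0] assms by (intro integrable_mult_right) simp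
    have "((\<lambda>\<xi>. exp (- \<epsilon> * \<xi>\<^sup>2)) \<longlongrightarrow> 0) F" if "filterlim (\<lambda>\<xi>. \<xi>\<^sup>2) at_top F" for F :: "real filter"
      using assms that by (intro filterlim_compose[OF exp_at_bot] filterlim_tendsto_neg_mult_at_bot[OF tendsto_const]) auto
    note lim = tendsto_mult_right_zero[OF this]
    show "(?g \<longlongrightarrow> 0) at_top"
      by (rule lim) (intro filterlim_pow_at_top filterlim_ident, simp)
    show "(?g \<longlongrightarrow> 0) at_bot"
      by (rule lim) (intro filterlim_pow_at_bot_even filterlim_ident, simp_all)
  qed
  have "Airy_reg \<epsilon> x y t = (\<integral>(\<xi>, \<eta>). zk_phase \<epsilon> x y t (of_real \<xi>) \<eta> \<partial>(lborel \<Otimes>\<^sub>M lborel))"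
    by (simp only: Airy_reg_def eq lborel_prod)
  also have "\<dots> = (\<integral>\<eta>. (\<integral>\<xi>. zk_phase \<epsilon> x y t (of_real \<xi>) \<eta> \<partial>lborel) \<partial>lborel)"
    using lborel_pair.integral_snd[OF int[of 0]] by simp
  also have "\<dots> = (\<integral>\<eta>. (\<integral>\<xi>. zk_phase \<epsilon> x y t (of_real \<xi> + \<i> * of_real \<alpha>) \<eta> \<partial>lborel) \<partial>lborel)"
    by (simp only: shift)
  also have "\<dots> = (\<integral>(\<xi>, \<eta>). zk_phase \<epsilon> x y t (of_real \<xi> + \<i> * of_real \<alpha>) \<eta> \<partial>lborel)"
    using lborel_pair.integral_snd[OF int[OF assms(3)]] by (simp add: lborel_prod)
  finally show ?thesis .
qed

text \<open>On the shifted contour the damping t \<alpha> remains when \<epsilon> = 0, so dominated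
  convergence along sequences in (0, 1) gives the limit defining the kernel as an absolutely
  convergent integral.\<close>

lemma Airy_kernel_shift:
  assumes "0 < t" "0 < \<alpha>"
  shows "Airy_kernel x y t
    = (\<integral>(\<xi>, \<eta>). zk_phase 0 x y t (of_real \<xi> + \<i> * of_real \<alpha>) \<eta> \<partial>lborel)" (is "_ = ?I 0")
proof -
  have "(?I \<longlongrightarrow> ?I 0) (at_right 0)"
  proof (rule tendsto_at_right_sequentially[of 0 1])
    fix S :: "nat \<Rightarrow> real" assume S: "\<And>n. 0 < S n" "\<And>n. S n < 1" "S \<longlonglongrightarrow> 0"
    show "(\<lambda>n. ?I (S n)) \<longlonglongrightarrow> ?I 0"
    proof (rule integral_dominated_convergence)
      show "integrable lborel (\<lambda>z. exp (1 * \<alpha>\<^sup>2 + t * \<alpha> ^ 3 + \<bar>x\<bar> * \<alpha>)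
          * (case z of (\<xi>, \<eta>) \<Rightarrow> exp (- (t * \<alpha>) * (\<xi>\<^sup>2 + \<eta>\<^sup>2))))"
        using assms by (intro integrable_mult_right integrable_gaussian_pair) simp
      show "AE z in lborel. (\<lambda>n. case z of (\<xi>, \<eta>) \<Rightarrow> zk_phase (S n) x y t (of_real \<xi> + \<i> * of_real \<alpha>) \<eta>)
          \<longlonglongrightarrow> (case z of (\<xi>, \<eta>) \<Rightarrow> zk_phase 0 x y t (of_real \<xi> + \<i> * of_real \<alpha>) \<eta>)"
        unfolding zk_phase_def case_prod_beta'
        by (intro AE_I2 tendsto_exp tendsto_add tendsto_mult tendsto_minus tendsto_const tendsto_of_real S(3))
      show "AE z in lborel. norm (case z of (\<xi>, \<eta>) \<Rightarrow> zk_phase (S n) x y t (of_real \<xi> + \<i> * of_real \<alpha>) \<eta>)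
          \<le> exp (1 * \<alpha>\<^sup>2 + t * \<alpha> ^ 3 + \<bar>x\<bar> * \<alpha>)
          * (case z of (\<xi>, \<eta>) \<Rightarrow> exp (- (t * \<alpha>) * (\<xi>\<^sup>2 + \<eta>\<^sup>2)))" for n
      proof -
        have "norm (zk_phase (S n) x y t (of_real \<xi> + \<i> * of_real \<alpha>) \<eta>)
          \<le> exp (1 * \<alpha>\<^sup>2 + t * \<alpha> ^ 3 + \<bar>x\<bar> * \<alpha>) * exp (- (t * \<alpha>) * (\<xi>\<^sup>2 + \<eta>\<^sup>2))" for \<xi> \<eta>
        proof -
          have "- (S n + t * \<alpha>) * (\<xi>\<^sup>2 + \<eta>\<^sup>2) \<le> - (t * \<alpha>) * (\<xi>\<^sup>2 + \<eta>\<^sup>2)"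
            using S(1)[of n] by (intro mult_right_mono) auto
          then show ?thesis
            using assms S(1)[of n] S(2)[of n]
            by (intro order_trans[OF norm_zk_phase_le[where \<epsilon>'=1] mult_left_mono]) auto
        qed
        then show ?thesis
          by (intro AE_I2) (simp only: case_prod_beta')
      qed
    qed (use zk_phase_pair_measurable[of _ x y t \<alpha> 0 1] in \<open>simp_all add: case_prod_beta'\<close>)
  qed simp
  moreover have "\<forall>\<^sub>F \<epsilon> in at_right 0. ?I \<epsilon> = Airy_reg \<epsilon> x y t"
    using eventually_at_right_less[of 0]
    by eventually_elim (use assms in \<open>simp add: Airy_reg_shift[of _ t \<alpha>]\<close>)
  ultimately have "((\<lambda>\<epsilon>. Airy_reg \<epsilon> x y t) \<longlongrightarrow> ?I 0) (at_right 0)"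
    by (rule Lim_transform_eventually)
  then show ?thesis
    unfolding Airy_kernel_def by (intro tendsto_Lim) auto
qed

text \<open>With M and N the two new frequencies, (M + N)^3 + 3 (M + N)(M - N)^2 = 4 M^3 + 4 N^3.
  Giving M and N the same imaginary part b shifts \<xi> = M + N by 2b and leaves \<eta> = sqrt 3 (M
  - N) real, which is why only the first frequency had to move.\<close>

lemma zk_phase_split:
  "zk_phase 0 x y t (of_real (\<nu> + \<mu>) + \<i> * of_real (2 * b)) (sqrt 3 * (\<mu> - \<nu>))
   = exp (\<i> * (4 * of_real t * (of_real \<mu> + \<i> * of_real b) ^ 3
              + of_real (x + sqrt 3 * y) * (of_real \<mu> + \<i> * of_real b)))
   * exp (\<i> * (4 * of_real t * (of_real \<nu> + \<i> * of_real b) ^ 3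
              + of_real (x - sqrt 3 * y) * (of_real \<nu> + \<i> * of_real b)))"
proof -
  define M N where "M = of_real \<mu> + \<i> * of_real b" and "N = of_real \<nu> + \<i> * of_real b"
  define r where "r = complex_of_real (sqrt 3)"
  have r2: "r\<^sup>2 = 3" by (simp add: r_def flip: of_real_power)
  have Z: "of_real (\<nu> + \<mu>) + \<i> * of_real (2 * b) = M + N" by (simp add: M_def N_def algebra_simps)
  have H: "of_real (sqrt 3 * (\<mu> - \<nu>)) = r * (M - N)" by (simp add: M_def N_def r_def)
  have "(M + N) ^ 3 + (M + N) * (r * (M - N))\<^sup>2 = 4 * M ^ 3 + 4 * N ^ 3"
    unfolding power_mult_distrib r2 by algebra
  then have key: "of_real t * (M + N) ^ 3 + of_real t * (M + N) * (r * (M - N))\<^sup>2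
      = 4 * of_real t * M ^ 3 + 4 * of_real t * N ^ 3"
    by (metis (no_types, opaque_lifting) distrib_left mult.assoc mult.left_commute)
  show ?thesis
    unfolding zk_phase_def Z H M_def[symmetric] N_def[symmetric] mult_exp_exp key
    by (simp add: r_def[symmetric] algebra_simps)
qed

lemma Airy_kernel_eq:
  assumes "0 < t"
  defines "\<tau> \<equiv> (12 * t) powr (1 / 3)"
  shows "Airy_kernel x y t = of_real (2 * sqrt 3 / \<tau>\<^sup>2)
     * airy ((x + sqrt 3 * y) / \<tau>) * airy ((x - sqrt 3 * y) / \<tau>)"
proof -
  have \<tau>: "\<tau> > 0" "\<tau> ^ 3 = 12 * t"
    using assms by (auto simp: powr_realpow[symmetric] powr_powr)
  \<comment> \<open>The height b is also the scaling factor: 4 t b^3 = 1/3 turns each cubic phase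
    into that of \<open>airy_integrand\<close>, on the line of imaginary part 1.\<close>
  define b where "b = 1 / \<tau>"
  have b: "b > 0" using \<tau> by (simp add: b_def)
  define G where "G p \<mu> = exp (\<i> * (4 * of_real t * (of_real \<mu> + \<i> * of_real b) ^ 3
              + of_real p * (of_real \<mu> + \<i> * of_real b)))" for p \<mu>
  have G: "(\<integral>\<mu>. G p \<mu> \<partial>lborel) = of_real b * airy (p / \<tau>)" for p
  proof -
    have "G p (0 + b * m) = airy_integrand (p / \<tau>) m" for m
    proof -
      let ?w = "of_real m + \<i>"
      have w: "of_real (b * m) + \<i> * of_real b = of_real b * ?w"
        by (simp add: algebra_simps)
      have "4 * of_real t * of_real b ^ 3 = complex_of_real (4 * t * b ^ 3)" by simp
      also have "4 * t * b ^ 3 = 1 / 3" using \<tau> assms(1) by (simp add: b_def field_simps)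
      finally have "4 * of_real t * (of_real b * ?w) ^ 3 = ?w ^ 3 / 3"
        by (simp add: power_mult_distrib mult.assoc[symmetric])
      moreover have "of_real p * (of_real b * ?w) = of_real (p / \<tau>) * ?w"
        by (simp add: b_def)
      ultimately show ?thesis
        unfolding G_def airy_integrand_def add_0_left w by (simp only:)
    qed
    then show ?thesis
      using lborel_integral_real_affine[of b "G p" 0] b
      by (simp add: airy_moment_def scaleR_conv_of_real)
  qed
  let ?Z = "zk_phase 0 x y t"
  let ?a = "2 * b"
  \<comment> \<open>The linear change of variables is done in two one-dimensional steps: \<eta> is
    replaced by \<nu> for fixed \<xi>, with Jacobian 2 sqrt 3, and then \<xi> = \<nu> + \<mu> for
    fixed \<nu>. The order of integration is swapped in between, which needs this
    integrability.\<close>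
  have int: "integrable (lborel \<Otimes>\<^sub>M lborel) (\<lambda>(\<xi>, \<nu>). ?Z (of_real \<xi> + \<i> * of_real ?a) (sqrt 3 * \<xi> + (- 2 * sqrt 3) * \<nu>))"
    unfolding lborel_prod
  proof (rule Bochner_Integration.integrable_bound)
    show "integrable lborel (\<lambda>z. exp (t * ?a ^ 3 - x * ?a)
        * (case z of (\<xi>, \<nu>) \<Rightarrow> exp (- (t * ?a) * (\<xi>\<^sup>2 + \<nu>\<^sup>2))))"
      using assms b by (intro integrable_mult_right integrable_gaussian_pair) simp
    have "norm (?Z (of_real \<xi> + \<i> * of_real ?a) (sqrt 3 * \<xi> + (- 2 * sqrt 3) * \<nu>))
       \<le> exp (t * ?a ^ 3 - x * ?a) * exp (- (t * ?a) * (\<xi>\<^sup>2 + \<nu>\<^sup>2))" for \<xi> \<nu>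
    proof -
      define \<eta> where "\<eta> = sqrt 3 * \<xi> + (- 2 * sqrt 3) * \<nu>"
      have "\<eta>\<^sup>2 = (sqrt 3)\<^sup>2 * (\<xi> - 2 * \<nu>)\<^sup>2"
        unfolding \<eta>_def power_mult_distrib[symmetric] by (simp add: algebra_simps)
      \<comment> \<open>The damping form equals 6 \<xi>^2 - 12 \<xi> \<nu> + 12 \<nu>^2; completing
        the square shows that it dominates \<xi>^2 + \<nu>^2.\<close>
      then have "(\<xi>\<^sup>2 + \<eta>\<^sup>2) + 2 * \<xi>\<^sup>2 = (\<xi>\<^sup>2 + \<nu>\<^sup>2) + (5 * (\<xi> - 6 / 5 * \<nu>)\<^sup>2 + 19 / 5 * \<nu>\<^sup>2)"
        by (simp add: power2_eq_square field_simps)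
      moreover have "0 \<le> 5 * (\<xi> - 6 / 5 * \<nu>)\<^sup>2 + 19 / 5 * \<nu>\<^sup>2" by simp
      ultimately have "\<xi>\<^sup>2 + \<nu>\<^sup>2 \<le> (\<xi>\<^sup>2 + \<eta>\<^sup>2) + 2 * \<xi>\<^sup>2" by linarith
      then have "t * ?a * (\<xi>\<^sup>2 + \<nu>\<^sup>2) \<le> t * ?a * ((\<xi>\<^sup>2 + \<eta>\<^sup>2) + 2 * \<xi>\<^sup>2)"
        using assms b by (intro mult_left_mono) auto
      then show ?thesis
        unfolding norm_zk_phase \<eta>_def[symmetric] exp_add[symmetric] by (simp add: algebra_simps)
    qed
    then show "AE z in lborel. norm (case z of (\<xi>, \<nu>) \<Rightarrow> ?Z (of_real \<xi> + \<i> * of_real ?a) (sqrt 3 * \<xi> + (- 2 * sqrt 3) * \<nu>))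
      \<le> norm (exp (t * ?a ^ 3 - x * ?a) * (case z of (\<xi>, \<nu>) \<Rightarrow> exp (- (t * ?a) * (\<xi>\<^sup>2 + \<nu>\<^sup>2))))"
      by (intro AE_I2) (auto simp: abs_mult)
  qed (use zk_phase_pair_measurable[of 0 x y t ?a "sqrt 3" "- 2 * sqrt 3"] in \<open>simp add: case_prod_beta'\<close>)
  have "Airy_kernel x y t = (\<integral>(\<xi>, \<eta>). ?Z (of_real \<xi> + \<i> * of_real ?a) \<eta> \<partial>lborel)"
    using assms b by (intro Airy_kernel_shift) auto
  also have "\<dots> = (\<integral>\<xi>. (\<integral>\<eta>. ?Z (of_real \<xi> + \<i> * of_real ?a) \<eta> \<partial>lborel) \<partial>lborel)"
    using lborel_pair.integral_fst[of "\<lambda>\<xi> \<eta>. ?Z (of_real \<xi> + \<i> * of_real ?a) \<eta>"]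
      integrable_zk_phase[of ?a t 0 x y] assms b by (simp add: lborel_prod)
  also have "\<dots> = (\<integral>\<xi>. (2 * sqrt 3) *\<^sub>R
      (\<integral>\<nu>. ?Z (of_real \<xi> + \<i> * of_real ?a) (sqrt 3 * \<xi> + (- 2 * sqrt 3) * \<nu>) \<partial>lborel) \<partial>lborel)"
    by (intro Bochner_Integration.integral_cong refl, subst lborel_integral_real_affine[where c="- 2 * sqrt 3"])
       simp_all
  also have "\<dots> = (2 * sqrt 3) *\<^sub>R
      (\<integral>\<nu>. (\<integral>\<xi>. ?Z (of_real \<xi> + \<i> * of_real ?a) (sqrt 3 * \<xi> + (- 2 * sqrt 3) * \<nu>) \<partial>lborel) \<partial>lborel)"
    unfolding integral_scaleR_right lborel_pair.Fubini_integral[OF int] ..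
  also have "(\<integral>\<nu>. (\<integral>\<xi>. ?Z (of_real \<xi> + \<i> * of_real ?a) (sqrt 3 * \<xi> + (- 2 * sqrt 3) * \<nu>) \<partial>lborel) \<partial>lborel)
     = (\<integral>\<nu>. (\<integral>\<mu>. ?Z (of_real (\<nu> + \<mu>) + \<i> * of_real ?a) (sqrt 3 * (\<mu> - \<nu>)) \<partial>lborel) \<partial>lborel)"
  proof (rule Bochner_Integration.integral_cong[OF refl])
    fix \<nu> :: real
    show "(\<integral>\<xi>. ?Z (of_real \<xi> + \<i> * of_real ?a) (sqrt 3 * \<xi> + (- 2 * sqrt 3) * \<nu>) \<partial>lborel)
       = (\<integral>\<mu>. ?Z (of_real (\<nu> + \<mu>) + \<i> * of_real ?a) (sqrt 3 * (\<mu> - \<nu>)) \<partial>lborel)"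
      by (subst lborel_integral_real_affine[where c=1 and t=\<nu>]) (simp_all add: algebra_simps)
  qed
  also have "\<dots> = (\<integral>\<nu>. (\<integral>\<mu>. G (x + sqrt 3 * y) \<mu> * G (x - sqrt 3 * y) \<nu> \<partial>lborel) \<partial>lborel)"
    unfolding zk_phase_split G_def ..
  also have "\<dots> = (of_real b * airy ((x + sqrt 3 * y) / \<tau>)) * (of_real b * airy ((x - sqrt 3 * y) / \<tau>))"
    by (simp add: G)
  finally show ?thesis
    by (simp add: b_def scaleR_conv_of_real power2_eq_square)
qed

section \<open>Size of the kernel\<close>

lemma Airy_kernel_measurable [measurable]:
  assumes "0 < t"
  shows "(\<lambda>(x, y). Airy_kernel x y t) \<in> borel_measurable borel"
  unfolding Airy_kernel_eq[OF assms] borel_prod[symmetric] by measurable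

text \<open>The product formula is even in y, so y may be replaced by |y|. For x \<ge> 0 the factor
  at x + sqrt 3 |y| decays exponentially and the other is bounded. For x \<le> 0 the argument x -
  sqrt 3 |y| is at most -|x|, which gives the power -1/4, while the other factor is exponentially
  small outside the cone |y| \<le> |x|.\<close>

lemma Airy_kernel_bounds:
  obtains C where "C > 0"
    "\<And>x y t \<tau>. 0 < t \<Longrightarrow> 0 \<le> x \<Longrightarrow> \<tau> = (12 * t) powr (1 / 3) \<Longrightarrow>
       norm (Airy_kernel x y t) \<le> C / \<tau>\<^sup>2 * (exp (- \<bar>x\<bar> / \<tau>) * exp (- \<bar>y\<bar> / \<tau>))"
    "\<And>x y t \<tau>. 0 < t \<Longrightarrow> x \<le> 0 \<Longrightarrow> \<tau> = (12 * t) powr (1 / 3) \<Longrightarrow>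
       norm (Airy_kernel x y t) \<le> C / \<tau>\<^sup>2 * ((1 + \<bar>x\<bar> / \<tau>) powr (- 1 / 4) * min 1 (exp ((\<bar>x\<bar> - \<bar>y\<bar>) / \<tau>)))"
proof -
  obtain C where C: "C > 0" and exp: "\<And>s. norm (airy s) \<le> C * exp (- s)"
    and neg: "\<And>s. s \<le> 0 \<Longrightarrow> norm (airy s) \<le> C * (1 - s) powr (- 1 / 4)"
    and bdd: "\<And>s. norm (airy s) \<le> C"
    using airy_bounds by blast
  define K where "K = 2 * sqrt 3 * C\<^sup>2"
  have K: "K > 0" using C by (simp add: K_def)
  have kernel: "norm (Airy_kernel x y t)
      = 2 * sqrt 3 / \<tau>\<^sup>2 * (norm (airy ((x + sqrt 3 * \<bar>y\<bar>) / \<tau>)) * norm (airy ((x - sqrt 3 * \<bar>y\<bar>) / \<tau>)))"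
    if "0 < t" "\<tau> = (12 * t) powr (1 / 3)" for x y t \<tau>
    unfolding Airy_kernel_eq[OF that(1)] that(2)[symmetric] norm_mult norm_of_real
    by (cases "y \<ge> 0") (simp_all add: mult_ac)
  have y_le: "\<bar>y\<bar> \<le> sqrt 3 * \<bar>y\<bar>" for y :: real
    using mult_right_mono[of 1 "sqrt 3" "\<bar>y\<bar>"] by simp
  show ?thesis
  proof (rule that[OF K])
    fix x y t \<tau> :: real
    assume t: "0 < t" and x: "0 \<le> x" and \<tau>_def: "\<tau> = (12 * t) powr (1 / 3)"
    have \<tau>: "\<tau> > 0" using t by (simp add: \<tau>_def)
    have "norm (airy ((x + sqrt 3 * \<bar>y\<bar>) / \<tau>)) \<le> C * exp (- ((x + sqrt 3 * \<bar>y\<bar>) / \<tau>))"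
      by (rule exp)
    also have "\<dots> \<le> C * (exp (- \<bar>x\<bar> / \<tau>) * exp (- \<bar>y\<bar> / \<tau>))"
      using C \<tau> x y_le[of y] by (intro mult_left_mono) (auto simp: divide_simps simp flip: exp_add)
    finally have "norm (airy ((x + sqrt 3 * \<bar>y\<bar>) / \<tau>)) * norm (airy ((x - sqrt 3 * \<bar>y\<bar>) / \<tau>))
        \<le> C * (exp (- \<bar>x\<bar> / \<tau>) * exp (- \<bar>y\<bar> / \<tau>)) * C"
      using bdd C by (intro mult_mono) auto
    then have "norm (Airy_kernel x y t) \<le> 2 * sqrt 3 / \<tau>\<^sup>2 * (C * (exp (- \<bar>x\<bar> / \<tau>) * exp (- \<bar>y\<bar> / \<tau>)) * C)"
      unfolding kernel[OF t \<tau>_def] by (intro mult_left_mono) auto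
    also have "\<dots> = K / \<tau>\<^sup>2 * (exp (- \<bar>x\<bar> / \<tau>) * exp (- \<bar>y\<bar> / \<tau>))"
      by (simp add: K_def power2_eq_square)
    finally show "norm (Airy_kernel x y t) \<le> K / \<tau>\<^sup>2 * (exp (- \<bar>x\<bar> / \<tau>) * exp (- \<bar>y\<bar> / \<tau>))" .
  next
    fix x y t \<tau> :: real
    assume t: "0 < t" and x: "x \<le> 0" and \<tau>_def: "\<tau> = (12 * t) powr (1 / 3)"
    have \<tau>: "\<tau> > 0" using t by (simp add: \<tau>_def)
    let ?P = "(1 + \<bar>x\<bar> / \<tau>) powr (- 1 / 4)"
    have "norm (airy ((x + sqrt 3 * \<bar>y\<bar>) / \<tau>)) \<le> C * exp (- ((x + sqrt 3 * \<bar>y\<bar>) / \<tau>))"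
      by (rule exp)
    also have "\<dots> \<le> C * exp ((\<bar>x\<bar> - \<bar>y\<bar>) / \<tau>)"
      using C \<tau> x y_le[of y] by (intro mult_left_mono) (auto simp: divide_simps)
    finally have 1: "norm (airy ((x + sqrt 3 * \<bar>y\<bar>) / \<tau>)) \<le> C * min 1 (exp ((\<bar>x\<bar> - \<bar>y\<bar>) / \<tau>))"
      using bdd[of "(x + sqrt 3 * \<bar>y\<bar>) / \<tau>"] by (simp add: min_def)
    have s: "(x - sqrt 3 * \<bar>y\<bar>) / \<tau> \<le> 0" "1 + \<bar>x\<bar> / \<tau> \<le> 1 - (x - sqrt 3 * \<bar>y\<bar>) / \<tau>"
      using x \<tau> order_trans[OF x, of "sqrt 3 * \<bar>y\<bar>"] by (auto simp: divide_simps)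
    have "norm (airy ((x - sqrt 3 * \<bar>y\<bar>) / \<tau>)) \<le> C * (1 - (x - sqrt 3 * \<bar>y\<bar>) / \<tau>) powr (- 1 / 4)"
      by (rule neg[OF s(1)])
    also have "\<dots> \<le> C * ?P"
      using C s(2) \<tau> by (intro mult_left_mono powr_mono2') (auto intro: add_pos_nonneg)
    finally have 2: "norm (airy ((x - sqrt 3 * \<bar>y\<bar>) / \<tau>)) \<le> C * ?P" .
    have "norm (Airy_kernel x y t) \<le> 2 * sqrt 3 / \<tau>\<^sup>2 * ((C * min 1 (exp ((\<bar>x\<bar> - \<bar>y\<bar>) / \<tau>))) * (C * ?P))"
      unfolding kernel[OF t \<tau>_def] using 1 2 C by (intro mult_left_mono mult_mono) auto
    also have "\<dots> = K / \<tau>\<^sup>2 * (?P * min 1 (exp ((\<bar>x\<bar> - \<bar>y\<bar>) / \<tau>)))"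
      by (simp add: K_def power2_eq_square)
    finally show "norm (Airy_kernel x y t) \<le> K / \<tau>\<^sup>2 * (?P * min 1 (exp ((\<bar>x\<bar> - \<bar>y\<bar>) / \<tau>)))" .
  qed
qed

section \<open>Integrals of the kernel majorants\<close>

lemma nn_integral_exp_abs_scaled:
  assumes "s > 0"
  shows "(\<integral>\<^sup>+y. ennreal (exp (- \<bar>y - r\<bar> / s)) \<partial>lborel) = ennreal (2 * s)"
proof -
  have "(\<integral>\<^sup>+y. ennreal (exp (- \<bar>y - r\<bar> / s)) \<partial>lborel)
      = ennreal \<bar>s\<bar> * (\<integral>\<^sup>+y. ennreal (exp (- \<bar>r + s * y - r\<bar> / s)) \<partial>lborel)"
    using assms by (intro nn_integral_real_affine) auto
  also have "(\<lambda>y. ennreal (exp (- \<bar>r + s * y - r\<bar> / s))) = (\<lambda>y. ennreal (exp (- \<bar>y\<bar>)))"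
    using assms by (simp add: abs_mult)
  also have "ennreal \<bar>s\<bar> * (\<integral>\<^sup>+y. ennreal (exp (- \<bar>y\<bar>)) \<partial>lborel) = ennreal (2 * s)"
    using assms by (simp add: nn_integral_exp_neg_abs ennreal_mult mult.commute)
  finally show ?thesis .
qed

text \<open>The interval [-r, r] contributes 2r. Beyond each endpoint the integrand is below a
  two-sided exponential centred there, of mass 2s.\<close>

lemma nn_integral_min_exp_le:
  assumes "s > 0" "r \<ge> 0"
  shows "(\<integral>\<^sup>+y. ennreal (min 1 (exp ((r - \<bar>y\<bar>) / s))) \<partial>lborel) \<le> ennreal (2 * r + 4 * s)"
proof -
  have "(\<integral>\<^sup>+y. ennreal (min 1 (exp ((r - \<bar>y\<bar>) / s))) \<partial>lborel)
      \<le> (\<integral>\<^sup>+y. indicator {- r..r} y + (ennreal (exp (- \<bar>y - r\<bar> / s)) + ennreal (exp (- \<bar>y - (- r)\<bar> / s))) \<partial>lborel)"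
  proof (rule nn_integral_mono)
    fix y :: real
    consider "\<bar>y\<bar> \<le> r" | "y > r" | "y < - r" by linarith
    then show "ennreal (min 1 (exp ((r - \<bar>y\<bar>) / s)))
        \<le> indicator {- r..r} y + (ennreal (exp (- \<bar>y - r\<bar> / s)) + ennreal (exp (- \<bar>y - (- r)\<bar> / s)))"
    proof cases
      case 1
      then have "ennreal (min 1 (exp ((r - \<bar>y\<bar>) / s))) \<le> indicator {- r..r} y"
        by (auto simp: indicator_def min_def ennreal_le_1)
      then show ?thesis by (rule order_trans) simp
    next
      case 2
      then have "ennreal (min 1 (exp ((r - \<bar>y\<bar>) / s))) \<le> ennreal (exp (- \<bar>y - r\<bar> / s))"
        using assms by (intro ennreal_leI) (auto simp: min_def)
      then show ?thesis by (rule order_trans) (simp add: add.left_commute)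
    next
      case 3
      then have "ennreal (min 1 (exp ((r - \<bar>y\<bar>) / s))) \<le> ennreal (exp (- \<bar>y - (- r)\<bar> / s))"
        using assms by (intro ennreal_leI) (auto simp: min_def)
      then show ?thesis by (rule order_trans) (simp add: add.assoc[symmetric])
    qed
  qed
  also have "\<dots> = ennreal (2 * r) + (ennreal (2 * s) + ennreal (2 * s))"
    using assms nn_integral_exp_abs_scaled[of s r] nn_integral_exp_abs_scaled[of s "- r"]
    by (subst nn_integral_add, simp, simp, subst nn_integral_add) (simp_all add: emeasure_lborel_Icc)
  also have "\<dots> = ennreal (2 * r + 4 * s)"
    using assms by (simp flip: ennreal_plus)
  finally show ?thesis .
qed

lemma nn_integral_powr_tail:
  fixes p v :: real
  assumes "p > 1" "v > 0"
  shows "(\<integral>\<^sup>+a. ennreal ((v - a) powr (- p)) * indicator {..0} a \<partial>lborel) = ennreal (v powr (1 - p) / (p - 1))"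
proof -
  have "(\<integral>\<^sup>+a. ennreal ((v - a) powr (- p)) * indicator {..0} a \<partial>lborel)
      = ennreal \<bar>-1\<bar> * (\<integral>\<^sup>+a. ennreal ((v - (v + (-1) * a)) powr (- p)) * indicator {..0} (v + (-1) * a) \<partial>lborel)"
    by (intro nn_integral_real_affine) auto
  also have "\<dots> = (\<integral>\<^sup>+a. ennreal (a powr (- p)) * indicator {v..} a \<partial>lborel)"
    by (auto simp: indicator_def intro!: nn_integral_cong)
  also have "\<dots> = ennreal (0 - v powr (1 - p) / (1 - p))"
  proof (rule nn_integral_FTC_atLeast)
    show "((\<lambda>a. a powr (1 - p) / (1 - p)) has_real_derivative a powr (- p)) (at a)" if "v \<le> a" for a
      using that assms by (auto intro!: derivative_eq_intros)
    show "((\<lambda>a. a powr (1 - p) / (1 - p)) \<longlongrightarrow> 0) at_top"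
      using assms by (intro tendsto_divide_zero tendsto_neg_powr filterlim_ident) auto
  qed auto
  also have "0 - v powr (1 - p) / (1 - p) = v powr (1 - p) / (p - 1)"
    using assms by (simp add: divide_simps) (simp add: algebra_simps)
  finally show ?thesis .
qed

lemma exp_neg_le_powr:
  fixes p :: real
  assumes "p > 0"
  obtains K where "K > 0" "\<And>v. v \<ge> 0 \<Longrightarrow> exp (- v) \<le> K * (1 + v) powr (- p)"
proof
  \<comment> \<open>The witness is the value of (1 + v) powr p times exp (-v) at its critical point
    1 + v = p; the bound is ln X \<le> X - 1 at X = (1 + v)/p.\<close>
  show "exp (1 - p + p * ln p) > 0" by simp
  show "exp (- v) \<le> exp (1 - p + p * ln p) * (1 + v) powr (- p)" if "v \<ge> 0" for v
  proof -
    have "ln ((1 + v) / p) \<le> (1 + v) / p - 1"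
      using that assms by (intro ln_le_minus_one) (auto intro!: divide_pos_pos)
    then have "p * (ln (1 + v) - ln p) \<le> p * ((1 + v) / p - 1)"
      using that assms by (intro mult_left_mono) (auto simp: ln_div)
    also have "\<dots> = 1 + v - p" using assms by (simp add: field_simps)
    finally have "- v \<le> (1 - p + p * ln p) + - p * ln (1 + v)" by (simp add: algebra_simps)
    then show ?thesis using that by (simp add: powr_def flip: exp_add)
  qed
qed

text \<open>Since \<tau> is at most of order (1 + u) powr (1/3), the quantity 1 + u/(4 \<tau>) is at
  least of order (1 + u) powr (2/3). Polynomial decay of order 3p/2 in it therefore becomes order p
  in 1 + u.\<close>

lemma exp_neg_div_le_powr:
  fixes p :: real
  assumes "p > 0"
  obtains K where "K > 0" "\<And>u \<tau>. 0 \<le> u \<Longrightarrow> 0 < \<tau> \<Longrightarrow> \<tau> \<le> 3 * (1 + u) powr (1 / 3) \<Longrightarrow>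
    exp (- u / (4 * \<tau>)) \<le> K * (1 + u) powr (- p)"
proof -
  obtain K where K: "K > 0" "\<And>v. v \<ge> 0 \<Longrightarrow> exp (- v) \<le> K * (1 + v) powr (- (3 / 2 * p))"
    using exp_neg_le_powr[of "3 / 2 * p"] assms by auto
  show ?thesis
  proof (rule that[of "K * 24 powr (3 / 2 * p)"])
    show "K * 24 powr (3 / 2 * p) > 0" using K(1) by simp
    fix u \<tau> :: real assume u: "0 \<le> u" and \<tau>: "0 < \<tau>" "\<tau> \<le> 3 * (1 + u) powr (1 / 3)"
    \<comment> \<open>For u > 1 the constant 24 is 2 * 12, from u \<ge> (1 + u)/2 and 4 \<tau> \<le>
      12 (1 + u) powr (1/3). For u \<le> 1 the summand 1 suffices.\<close>
    have "(1 + u) powr (2 / 3) / 24 \<le> 1 + u / (4 * \<tau>)"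
    proof (cases "u \<le> 1")
      case True
      have "(1 + u) powr (2 / 3) \<le> 2 powr (2 / 3)" using True u by (intro powr_mono2) auto
      also have "\<dots> \<le> 2 powr 1" by (intro powr_mono) auto
      finally have "(1 + u) powr (2 / 3) / 24 \<le> 1" by simp
      also have "1 \<le> 1 + u / (4 * \<tau>)" using u \<tau> by simp
      finally show ?thesis .
    next
      case False
      have "(1 + u) powr (2 / 3) / 24 * (12 * (1 + u) powr (1 / 3)) = (1 + u) / 2"
        using u by (simp add: powr_add[symmetric])
      also have "\<dots> \<le> u" using False by simp
      finally have "(1 + u) powr (2 / 3) / 24 \<le> u / (12 * (1 + u) powr (1 / 3))"
        using u by (simp add: pos_le_divide_eq mult_ac)
      also have "\<dots> \<le> u / (4 * \<tau>)" using u \<tau> by (intro divide_left_mono) auto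
      finally show ?thesis by simp
    qed
    then have "(1 + u / (4 * \<tau>)) powr (- (3 / 2 * p)) \<le> ((1 + u) powr (2 / 3) / 24) powr (- (3 / 2 * p))"
      using u assms by (intro powr_mono2') auto
    also have "\<dots> = 24 powr (3 / 2 * p) * (1 + u) powr (- p)"
      using u by (simp add: powr_divide powr_powr powr_minus_divide)
    finally have "K * (1 + u / (4 * \<tau>)) powr (- (3 / 2 * p)) \<le> K * (24 powr (3 / 2 * p) * (1 + u) powr (- p))"
      using K(1) by (intro mult_left_mono) auto
    with K(2)[of "u / (4 * \<tau>)"] u \<tau> show "exp (- u / (4 * \<tau>)) \<le> K * 24 powr (3 / 2 * p) * (1 + u) powr (- p)"
      by simp
  qed
qed

lemma nn_integral_exp_abs_pair:
  assumes "\<tau> > 0"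
  shows "(\<integral>\<^sup>+(a, b). ennreal (exp (- \<bar>a\<bar> / (2 * \<tau>)) * exp (- \<bar>b\<bar> / \<tau>)) \<partial>lborel) = ennreal (8 * \<tau>\<^sup>2)"
proof -
  have "(\<integral>\<^sup>+(a, b). ennreal (exp (- \<bar>a\<bar> / (2 * \<tau>)) * exp (- \<bar>b\<bar> / \<tau>)) \<partial>lborel)
      = (\<integral>\<^sup>+a. (\<integral>\<^sup>+b. ennreal (exp (- \<bar>a\<bar> / (2 * \<tau>))) * ennreal (exp (- \<bar>b\<bar> / \<tau>)) \<partial>lborel) \<partial>lborel)"
    unfolding lborel_prod[symmetric] by (subst lborel.nn_integral_fst[symmetric]) (simp_all add: ennreal_mult)
  also have "\<dots> = (\<integral>\<^sup>+a. ennreal (exp (- \<bar>a\<bar> / (2 * \<tau>))) * ennreal (2 * \<tau>) \<partial>lborel)"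
    using nn_integral_exp_abs_scaled[of \<tau> 0] assms by (subst nn_integral_cmult) simp_all
  also have "\<dots> = ennreal (2 * (2 * \<tau>)) * ennreal (2 * \<tau>)"
    using nn_integral_exp_abs_scaled[of "2 * \<tau>" 0] assms by (subst nn_integral_multc) simp_all
  also have "\<dots> = ennreal (8 * \<tau>\<^sup>2)"
    using assms by (simp add: power2_eq_square flip: ennreal_mult)
  finally show ?thesis .
qed

text \<open>The main term. The b-integral is of the order of the cone width |a| + \<tau>; against
  the factor of power -1/4 this leaves \<tau> powr (1/4) times (1 + u + |a|) powr (3/4). The
  remaining a-integral has exponent 3/4 - \<sigma>, and convergence at infinity is the condition
  \<sigma> > 7/4.\<close>

lemma nn_integral_cone_le:
  assumes \<sigma>: "\<sigma> > 7 / 4" and "u \<ge> 0" and \<tau>: "0 < \<tau>" "\<tau> \<le> 3 * (1 + u)"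
  shows "(\<integral>\<^sup>+(a, b). ennreal ((1 + \<bar>a\<bar> / \<tau>) powr (- 1 / 4) * min 1 (exp ((\<bar>a\<bar> - \<bar>b\<bar>) / \<tau>)))
        * (ennreal ((1 + u + \<bar>a\<bar>) powr (- \<sigma>)) * indicator {..0} a) \<partial>lborel)
     \<le> ennreal (12 / (\<sigma> - 7 / 4) * \<tau> powr (1 / 4) * (1 + u) powr (7 / 4 - \<sigma>))" (is "?L \<le> _")
proof -
  have "?L = (\<integral>\<^sup>+a. (\<integral>\<^sup>+b. ennreal ((1 + \<bar>a\<bar> / \<tau>) powr (- 1 / 4) * min 1 (exp ((\<bar>a\<bar> - \<bar>b\<bar>) / \<tau>)))
        * (ennreal ((1 + u + \<bar>a\<bar>) powr (- \<sigma>)) * indicator {..0} a) \<partial>lborel) \<partial>lborel)"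
    unfolding lborel_prod[symmetric] by (subst lborel.nn_integral_fst[symmetric]) simp_all
  also have "\<dots> \<le> (\<integral>\<^sup>+a. ennreal (12 * \<tau> powr (1 / 4)) * (ennreal ((1 + u - a) powr (- (\<sigma> - 3 / 4))) * indicator {..0} a) \<partial>lborel)"
  proof (rule nn_integral_mono)
    fix a :: real
    let ?q = "1 + \<bar>a\<bar> / \<tau>"
    have q: "?q > 0" using \<tau> by (simp add: add_pos_nonneg)
    show "(\<integral>\<^sup>+b. ennreal (?q powr (- 1 / 4) * min 1 (exp ((\<bar>a\<bar> - \<bar>b\<bar>) / \<tau>)))
        * (ennreal ((1 + u + \<bar>a\<bar>) powr (- \<sigma>)) * indicator {..0} a) \<partial>lborel)
      \<le> ennreal (12 * \<tau> powr (1 / 4)) * (ennreal ((1 + u - a) powr (- (\<sigma> - 3 / 4))) * indicator {..0} a)"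
    proof (cases "a \<le> 0")
      case True
      let ?w = "1 + u + \<bar>a\<bar>"
      have "(\<integral>\<^sup>+b. ennreal (?q powr (- 1 / 4) * min 1 (exp ((\<bar>a\<bar> - \<bar>b\<bar>) / \<tau>))) * ennreal (?w powr (- \<sigma>)) \<partial>lborel)
          = ennreal (?q powr (- 1 / 4)) * (\<integral>\<^sup>+b. ennreal (min 1 (exp ((\<bar>a\<bar> - \<bar>b\<bar>) / \<tau>))) \<partial>lborel) * ennreal (?w powr (- \<sigma>))"
        by (subst nn_integral_multc, simp, subst nn_integral_cmult[symmetric]) (simp_all add: ennreal_mult)
      also have "\<dots> \<le> ennreal (?q powr (- 1 / 4)) * ennreal (2 * \<bar>a\<bar> + 4 * \<tau>) * ennreal (?w powr (- \<sigma>))"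
        using \<tau> by (intro mult_right_mono mult_left_mono nn_integral_min_exp_le) auto
      also have "\<dots> = ennreal (?q powr (- 1 / 4) * (2 * \<bar>a\<bar> + 4 * \<tau>) * ?w powr (- \<sigma>))"
        using \<tau> by (simp add: ennreal_mult)
      also have "\<dots> \<le> ennreal (12 * \<tau> powr (1 / 4) * ?w powr (- (\<sigma> - 3 / 4)))"
      proof (intro ennreal_leI)
        have "?q = (\<tau> + \<bar>a\<bar>) / \<tau>" using \<tau> by (simp add: add_divide_distrib)
        also have "\<dots> \<le> 3 * ?w / \<tau>" using \<tau> by (intro divide_right_mono) auto
        finally have qw: "?q \<le> 3 * ?w / \<tau>" .
        \<comment> \<open>Writing the cone width as a multiple of \<tau> q leaves the power 3/4 of
          q. The constant 12 comes from this 4 and from 3 powr (3/4) \<le> 3.\<close>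
        have "?q powr (- 1 / 4) * (2 * \<bar>a\<bar> + 4 * \<tau>) \<le> ?q powr (- 1 / 4) * (4 * \<tau> * ?q)"
          using \<tau> by (intro mult_left_mono) (auto simp: field_simps)
        also have "\<dots> = 4 * \<tau> * (?q * ?q powr (- 1 / 4))" by (simp only: mult_ac)
        also have "?q * ?q powr (- 1 / 4) = ?q powr (3 / 4)"
          using q powr_mult_base[of ?q "- 1 / 4"] by simp
        also have "?q powr (3 / 4) \<le> (3 * ?w / \<tau>) powr (3 / 4)"
          using q qw by (intro powr_mono2) auto
        also have "\<dots> = 3 powr (3 / 4) * ?w powr (3 / 4) * \<tau> powr (- (3 / 4))"
          unfolding powr_divide powr_mult powr_minus_divide by simp
        also have "\<dots> \<le> 3 powr 1 * ?w powr (3 / 4) * \<tau> powr (- (3 / 4))"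
          by (intro mult_right_mono powr_mono) auto
        also have "4 * \<tau> * (3 powr 1 * ?w powr (3 / 4) * \<tau> powr (- (3 / 4))) = 12 * \<tau> powr (1 / 4) * ?w powr (3 / 4)"
          using \<tau> powr_mult_base[of \<tau> "- (3 / 4)"] by (simp add: mult_ac)
        finally have "?q powr (- 1 / 4) * (2 * \<bar>a\<bar> + 4 * \<tau>) \<le> 12 * \<tau> powr (1 / 4) * ?w powr (3 / 4)"
          using \<tau> by simp
        then have "?q powr (- 1 / 4) * (2 * \<bar>a\<bar> + 4 * \<tau>) * ?w powr (- \<sigma>)
            \<le> 12 * \<tau> powr (1 / 4) * ?w powr (3 / 4) * ?w powr (- \<sigma>)"
          by (intro mult_right_mono) auto
        also have "\<dots> = 12 * \<tau> powr (1 / 4) * ?w powr (- (\<sigma> - 3 / 4))"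
          by (simp add: powr_add[symmetric])
        finally show "?q powr (- 1 / 4) * (2 * \<bar>a\<bar> + 4 * \<tau>) * ?w powr (- \<sigma>)
            \<le> 12 * \<tau> powr (1 / 4) * ?w powr (- (\<sigma> - 3 / 4))" .
      qed
      finally show ?thesis
        using True by (simp add: ennreal_mult)
    qed simp
  qed
  also have "\<dots> = ennreal (12 * \<tau> powr (1 / 4)) * ennreal ((1 + u) powr (1 - (\<sigma> - 3 / 4)) / (\<sigma> - 3 / 4 - 1))"
    using assms by (subst nn_integral_cmult, simp, subst nn_integral_powr_tail) simp_all
  also have "\<dots> = ennreal (12 * \<tau> powr (1 / 4) * ((1 + u) powr (7 / 4 - \<sigma>) / (\<sigma> - 7 / 4)))"
    using \<sigma> by (subst ennreal_mult[symmetric]) (auto simp: algebra_simps)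
  finally show ?thesis by (simp add: mult_ac)
qed

section \<open>Weights\<close>

text \<open>Reflection is the linear map with all diagonal entries -1. It is needed for the
  completed measure because \<phi> is only assumed Lebesgue measurable.\<close>

lemma
  fixes p :: "'a::euclidean_space"
  shows lebesgue_measurable_reflect: "(\<lambda>z. p - z) \<in> lebesgue \<rightarrow>\<^sub>M lebesgue"
    and distr_lebesgue_reflect: "distr lebesgue lebesgue (\<lambda>z. p - z) = lebesgue"
proof -
  have eq: "(\<lambda>x. p + (\<Sum>j\<in>Basis. ((-1) * (x \<bullet> j)) *\<^sub>R j)) = (\<lambda>z. p - z)"
    by (simp add: sum_negf euclidean_representation)
  show "(\<lambda>z. p - z) \<in> lebesgue \<rightarrow>\<^sub>M lebesgue"
    using lebesgue_affine_measurable[of "\<lambda>_. -1" p] unfolding eq by simp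
  show "distr lebesgue lebesgue (\<lambda>z. p - z) = lebesgue"
    using lebesgue_affine_euclidean[of "\<lambda>_. -1" p] unfolding eq by (simp add: density_1)
qed

lemma japanese_ge: "1 \<le> japanese x" "\<bar>x\<bar> \<le> japanese x" "japanese x \<le> 1 + \<bar>x\<bar>"
proof -
  show "1 \<le> japanese x" "\<bar>x\<bar> \<le> japanese x" by (auto simp: japanese_def intro!: real_le_rsqrt)
  have "1 + x\<^sup>2 \<le> (1 + \<bar>x\<bar>)\<^sup>2" by (simp add: power2_eq_square algebra_simps flip: abs_mult)
  then show "japanese x \<le> 1 + \<bar>x\<bar>" unfolding japanese_def by (intro real_le_lsqrt) auto
qed

lemma japanese_powr_neg_le:
  assumes "0 \<le> \<sigma>"
  shows "japanese x powr (- \<sigma>) \<le> 2 powr \<sigma> * (1 + \<bar>x\<bar>) powr (- \<sigma>)"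
proof -
  have "japanese x powr (- \<sigma>) \<le> ((1 + \<bar>x\<bar>) / 2) powr (- \<sigma>)"
    using japanese_ge[of x] assms by (intro powr_mono2') auto
  also have "\<dots> = 2 powr \<sigma> * (1 + \<bar>x\<bar>) powr (- \<sigma>)"
    by (simp add: powr_divide powr_minus_divide)
  finally show ?thesis .
qed

text \<open>The squared integrand of the weighted norm on the left half plane, extended by zero so
  that it can be reflected and translated on the whole plane.\<close>

definition weighted_sq :: "(real \<Rightarrow> real \<Rightarrow> real) \<Rightarrow> real \<times> real \<Rightarrow> real" where
  "weighted_sq \<phi> z = indicator ({..<0} \<times> UNIV) z * (inverse (japanese (fst z)) * \<phi> (fst z) (snd z))\<^sup>2"

lemma weighted_sq_integral:
  assumes "admissible \<sigma> c \<phi>" "0 < c"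
  shows "integrable lebesgue (weighted_sq \<phi>)"
    and "(\<integral>\<^sup>+z. ennreal (weighted_sq \<phi> z) \<partial>lebesgue) \<le> ennreal (c\<^sup>2)"
proof -
  have eq: "weighted_sq \<phi> = (\<lambda>z. indicator ({..<0} \<times> UNIV) z *\<^sub>R
      ((case z of (x, y) \<Rightarrow> inverse (japanese x) * \<phi> x y))\<^sup>2)"
    by (auto simp: weighted_sq_def fun_eq_iff)
  show int: "integrable lebesgue (weighted_sq \<phi>)"
    using assms(1) unfolding admissible_def L2_on_def set_integrable_def eq by simp
  have "sqrt (\<integral>z. weighted_sq \<phi> z \<partial>lebesgue) \<le> c"
    using assms(1) unfolding admissible_def L2_norm_on_def set_lebesgue_integral_def eq by simp
  then have "(\<integral>z. weighted_sq \<phi> z \<partial>lebesgue) \<le> c\<^sup>2"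
    by (rule sqrt_le_D)
  moreover have "(\<integral>\<^sup>+z. ennreal (weighted_sq \<phi> z) \<partial>lebesgue) = ennreal (\<integral>z. weighted_sq \<phi> z \<partial>lebesgue)"
    by (rule nn_integral_eq_integral[OF int]) (auto simp: weighted_sq_def)
  ultimately show "(\<integral>\<^sup>+z. ennreal (weighted_sq \<phi> z) \<partial>lebesgue) \<le> ennreal (c\<^sup>2)"
    by (simp add: ennreal_leI)
qed

lemma Phi_integrand_measurable:
  assumes "admissible \<sigma> c \<phi>" "0 < t"
  shows "Phi_integrand \<phi> x y t \<in> borel_measurable lebesgue"
proof -
  have "(\<lambda>z. case z of (v, w) \<Rightarrow> \<phi> v w) \<in> borel_measurable lebesgue"
    using assms(1) by (simp add: admissible_def)
  from measurable_compose[OF lebesgue_measurable_reflect[of "(x + t, y)"] this]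
  have [measurable]: "(\<lambda>z. \<phi> (x + t - fst z) (y - snd z)) \<in> borel_measurable lebesgue"
    by (simp add: case_prod_beta')
  have [measurable]: "(\<lambda>z. Airy_kernel (fst z) (snd z) t) \<in> borel_measurable lebesgue"
    using Airy_kernel_measurable[OF assms(2)] by (intro measurable_completion) (simp add: case_prod_beta')
  show ?thesis
    unfolding Phi_integrand_def case_prod_beta' by measurable
qed

text \<open>If a \<le> u/2, the weight is evaluated at distance at least u/2 and already has the
  desired size. Otherwise half of the exponential is at most exp (- u/(4 \<tau>)), which beats the
  required power. In both cases the other half is kept for integration in a.\<close>

lemma near_field_weight_le:
  fixes \<sigma> a u \<tau> K :: real
  assumes "0 \<le> \<sigma>" "0 < a" "a < u" "0 < \<tau>"
    and decay: "exp (- u / (4 * \<tau>)) \<le> K * (1 + u) powr (- (\<sigma> + 1))" and "0 \<le> K"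
  shows "exp (- a / \<tau>) * (1 + (u - a)) powr (- \<sigma>) \<le> (2 powr \<sigma> + K) * (1 + u) powr (- \<sigma>) * exp (- a / (2 * \<tau>))"
proof (cases "a \<le> u / 2")
  case True
  have "(1 + (u - a)) powr (- \<sigma>) \<le> ((1 + u) / 2) powr (- \<sigma>)"
    using True assms by (intro powr_mono2') auto
  also have "\<dots> = 2 powr \<sigma> * (1 + u) powr (- \<sigma>)"
    using assms by (simp add: powr_divide powr_minus_divide)
  also have "\<dots> \<le> (2 powr \<sigma> + K) * (1 + u) powr (- \<sigma>)"
    using assms by (intro mult_right_mono) auto
  finally have "exp (- a / \<tau>) * (1 + (u - a)) powr (- \<sigma>)
      \<le> exp (- a / (2 * \<tau>)) * ((2 powr \<sigma> + K) * (1 + u) powr (- \<sigma>))"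
    using assms by (intro mult_mono) (auto simp: divide_simps)
  then show ?thesis by (simp add: mult_ac)
next
  case False
  have "(1 + (u - a)) powr (- \<sigma>) \<le> 1 powr (- \<sigma>)"
    using assms by (intro powr_mono2') auto
  then have "exp (- a / \<tau>) * (1 + (u - a)) powr (- \<sigma>) \<le> exp (- a / \<tau>) * 1"
    by (intro mult_left_mono) auto
  also have "exp (- a / \<tau>) * 1 = exp (- a / (2 * \<tau>)) * exp (- a / (2 * \<tau>))"
    using assms by (simp flip: exp_add)
  also have "\<dots> \<le> exp (- u / (4 * \<tau>)) * exp (- a / (2 * \<tau>))"
    using False assms by (intro mult_right_mono) (auto simp: divide_simps)
  also have "\<dots> \<le> (K * (1 + u) powr (- (\<sigma> + 1))) * exp (- a / (2 * \<tau>))"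
    using decay by (intro mult_right_mono) auto
  also have "\<dots> \<le> ((2 powr \<sigma> + K) * (1 + u) powr (- \<sigma>)) * exp (- a / (2 * \<tau>))"
    using assms by (intro mult_right_mono mult_mono powr_mono) auto
  finally show ?thesis .
qed

text \<open>The growth of \<open>japanese (u - a)\<close>, at most 1 + a, costs one power, which is
  why the exponential decay is taken with exponent \<sigma> + 1. At least half of the exponential is
  kept for integration.\<close>

lemma far_field_weight_le:
  fixes \<sigma> a u \<tau> K :: real
  assumes "0 \<le> \<sigma>" "0 \<le> u" "u \<le> a" "0 < \<tau>"
    and decay: "exp (- a / (4 * \<tau>)) \<le> K * (1 + a) powr (- (\<sigma> + 1))" and "0 \<le> K"
  shows "exp (- a / \<tau>) * japanese (u - a) \<le> K * (1 + u) powr (- \<sigma>) * exp (- a / (2 * \<tau>))"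
proof -
  have "exp (- a / \<tau>) \<le> exp (- a / (4 * \<tau>)) * exp (- a / (2 * \<tau>))"
    using assms by (auto simp: divide_simps simp flip: exp_add)
  also have "\<dots> \<le> (K * (1 + a) powr (- (\<sigma> + 1))) * exp (- a / (2 * \<tau>))"
    using decay by (intro mult_right_mono) auto
  finally have "exp (- a / \<tau>) * japanese (u - a)
      \<le> (K * (1 + a) powr (- (\<sigma> + 1))) * exp (- a / (2 * \<tau>)) * (1 + a)"
    using japanese_ge[of "u - a"] assms by (intro mult_mono) auto
  also have "\<dots> = K * ((1 + a) * (1 + a) powr (- (\<sigma> + 1))) * exp (- a / (2 * \<tau>))"
    by (simp only: mult_ac)
  also have "(1 + a) * (1 + a) powr (- (\<sigma> + 1)) = (1 + a) powr (- \<sigma>)"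
    using powr_mult_base[of "1 + a" "- (\<sigma> + 1)"] assms by simp
  also have "K * (1 + a) powr (- \<sigma>) * exp (- a / (2 * \<tau>)) \<le> K * (1 + u) powr (- \<sigma>) * exp (- a / (2 * \<tau>))"
    using assms by (intro mult_right_mono mult_left_mono powr_mono2') auto
  finally show ?thesis .
qed

text \<open>Applied with w = 1 + x + t, these compare every error term with the size
  \<open>B\<close> of the main term. The time power arises because \<tau> powr (1/4 - 2) equals (12
  t) powr (-7/12).\<close>

lemma scale_bounds:
  fixes t w \<tau> \<sigma> :: real
  assumes t: "0 < t" and w: "1 \<le> w" "t \<le> w" and \<tau>_def: "\<tau> = (12 * t) powr (1 / 3)"
  defines "B \<equiv> t powr (- 7 / 12) * w powr (7 / 4 - \<sigma>)"
  shows "\<tau> \<le> 3 * w powr (1 / 3)" "\<tau> \<le> 3 * w" "\<tau> powr (1 / 4) / \<tau>\<^sup>2 \<le> t powr (- 7 / 12)"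
    "w powr (- \<sigma>) \<le> B" "w powr (- \<sigma>) / \<tau> \<le> B"
proof -
  have \<tau>: "\<tau> > 0" using t by (simp add: \<tau>_def)
  \<comment> \<open>12 is rounded up to the cube 27.\<close>
  have "\<tau> \<le> (27 * w) powr (1 / 3)"
    unfolding \<tau>_def using t w by (intro powr_mono2) auto
  also have "\<dots> = 27 powr (1 / 3) * w powr (1 / 3)" by (rule powr_mult)
  also have "27 powr (1 / 3) = (3 :: real)"
    using powr_powr[of "3::real" 3 "1 / 3"] by simp
  finally show 1: "\<tau> \<le> 3 * w powr (1 / 3)" .
  have "w powr (1 / 3) \<le> w powr 1" using w by (intro powr_mono) auto
  with 1 w show "\<tau> \<le> 3 * w" by simp
  have "\<tau> powr (1 / 4) / \<tau>\<^sup>2 = \<tau> powr (1 / 4 - 2)"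
    using \<tau> powr_diff[of \<tau> "1 / 4" 2] by simp
  also have "\<dots> = (12 * t) powr (- 7 / 12)"
    unfolding \<tau>_def by (simp add: powr_powr)
  also have "\<dots> \<le> t powr (- 7 / 12)" using t by (intro powr_mono2') auto
  finally show "\<tau> powr (1 / 4) / \<tau>\<^sup>2 \<le> t powr (- 7 / 12)" .
  \<comment> \<open>Powers of t beyond -7/12 are traded for powers of w, of which 7/4 are available.
    It is applied with q = 0 and q = -1/3.\<close>
  have t_w: "t powr q * w powr (- \<sigma>) \<le> B" if "0 \<le> q + 7 / 12" "q + 7 / 12 \<le> 7 / 4" for q
  proof -
    have "t powr q * w powr (- \<sigma>) = t powr (- 7 / 12) * (t powr (q + 7 / 12) * w powr (- \<sigma>))"
      using t by (simp add: mult.assoc[symmetric] powr_add[symmetric])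
    also have "t powr (q + 7 / 12) \<le> w powr (q + 7 / 12)"
      using t w that by (intro powr_mono2) auto
    also have "w powr (q + 7 / 12) \<le> w powr (7 / 4)"
      using w that by (intro powr_mono) auto
    also have "w powr (7 / 4) * w powr (- \<sigma>) = w powr (7 / 4 - \<sigma>)"
      by (simp add: powr_add[symmetric])
    finally show ?thesis by (simp add: B_def mult_left_mono mult_right_mono)
  qed
  show "w powr (- \<sigma>) \<le> B" using t_w[of 0] t by simp
  have "w powr (- \<sigma>) / \<tau> = (12 * t) powr (- (1 / 3)) * w powr (- \<sigma>)"
    by (simp add: \<tau>_def powr_minus_divide)
  also have "\<dots> \<le> t powr (- (1 / 3)) * w powr (- \<sigma>)"
    using t by (intro mult_right_mono powr_mono2') auto
  also have "\<dots> \<le> B" by (rule t_w) auto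
  finally show "w powr (- \<sigma>) / \<tau> \<le> B" .
qed

section \<open>The convolution\<close>

text \<open>Expanding a square gives Cauchy--Schwarz pointwise, with a free parameter r to balance
  the two sides after integration.\<close>

lemma mult_le_half_sum_squares:
  fixes h \<psi> r :: real
  assumes "r > 0"
  shows "h * \<psi> \<le> (h\<^sup>2 * r + \<psi>\<^sup>2 / r) / 2"
proof -
  have "0 \<le> (h * r - \<psi>)\<^sup>2 / r" using assms by simp
  also have "\<dots> = h\<^sup>2 * r + \<psi>\<^sup>2 / r - 2 * (h * \<psi>)"
    using assms by (simp add: power2_eq_square field_simps)
  finally show ?thesis by simp
qed

text \<open>With kernel variable (a, b), \<phi> is evaluated at first coordinate u - a, where u = x
  + t. The regions are a \<le> 0 (oscillating kernel, decaying data), 0 < a < u (exponentially small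
  kernel, decaying data) and a > u (exponentially small kernel, data controlled only in the weighted
  square norm). Bounding the integral of the norm gives integrability and the estimate
  together.\<close>

lemma Phi_integrand_bound:
  fixes \<sigma> :: real
  assumes \<sigma>: "\<sigma> > 9 / 4"
  obtains K where "K > 0" "\<And>\<phi> c x y t. 0 < c \<Longrightarrow> admissible \<sigma> c \<phi> \<Longrightarrow> 0 < t \<Longrightarrow> 0 < x \<Longrightarrow>
    (\<integral>\<^sup>+z. ennreal (norm (Phi_integrand \<phi> x y t z)) \<partial>lebesgue)
      \<le> ennreal (K * c * (t powr (- 7 / 12) * (1 + x + t) powr (7 / 4 - \<sigma>)))"
proof -
  obtain C where C: "C > 0"
    and pos: "\<And>x y t \<tau>. 0 < t \<Longrightarrow> 0 \<le> x \<Longrightarrow> \<tau> = (12 * t) powr (1 / 3) \<Longrightarrow>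
       norm (Airy_kernel x y t) \<le> C / \<tau>\<^sup>2 * (exp (- \<bar>x\<bar> / \<tau>) * exp (- \<bar>y\<bar> / \<tau>))"
    and neg: "\<And>x y t \<tau>. 0 < t \<Longrightarrow> x \<le> 0 \<Longrightarrow> \<tau> = (12 * t) powr (1 / 3) \<Longrightarrow>
       norm (Airy_kernel x y t) \<le> C / \<tau>\<^sup>2 * ((1 + \<bar>x\<bar> / \<tau>) powr (- 1 / 4) * min 1 (exp ((\<bar>x\<bar> - \<bar>y\<bar>) / \<tau>)))"
    using Airy_kernel_bounds by blast
  obtain D where D: "D > 0" and decay: "\<And>u \<tau>. 0 \<le> u \<Longrightarrow> 0 < \<tau> \<Longrightarrow> \<tau> \<le> 3 * (1 + u) powr (1 / 3) \<Longrightarrow>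
    exp (- u / (4 * \<tau>)) \<le> D * (1 + u) powr (- (\<sigma> + 1))"
    using exp_neg_div_le_powr[of "\<sigma> + 1"] \<sigma> by auto
  define L where "L = 2 powr \<sigma> * (2 powr \<sigma> + D)"
  \<comment> \<open>The summands belong, in this order, to the region a \<le> 0, the region 0 < a <
    u, and the kernel and data halves of the split product for a > u.\<close>
  define K where "K = C * 2 powr \<sigma> * (12 / (\<sigma> - 7 / 4)) + 8 * C * L + 4 * C\<^sup>2 * D\<^sup>2 + 1 / 2"
  have L: "L > 0" using D by (simp add: L_def add_pos_pos)
  have K: "K > 0" using C D L \<sigma> by (auto simp: K_def intro!: add_nonneg_pos add_nonneg_nonneg)
  show ?thesis
  proof (rule that[OF K])
    fix \<phi> :: "real \<Rightarrow> real \<Rightarrow> real" and c x y t :: real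
    assume c: "0 < c" and adm: "admissible \<sigma> c \<phi>" and t: "0 < t" and x: "0 < x"
    define \<tau> where "\<tau> = (12 * t) powr (1 / 3)"
    define u where "u = x + t"
    define w where "w = 1 + u"
    define B where "B = t powr (- 7 / 12) * w powr (7 / 4 - \<sigma>)"
    define \<beta> where "\<beta> = w powr (- \<sigma>)"
    have \<tau>: "\<tau> > 0" using t by (simp add: \<tau>_def)
    have w: "1 \<le> w" "t \<le> w" "0 \<le> u" using t x by (auto simp: w_def u_def)
    note sb = scale_bounds(1-3)[OF t w(1,2) \<tau>_def]
      scale_bounds(4,5)[OF t w(1,2) \<tau>_def, of \<sigma>, folded B_def \<beta>_def]
    have B: "B > 0" using t w by (simp add: B_def)
    have \<beta>: "\<beta> > 0" using w by (simp add: \<beta>_def)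
    define M where "M z = (case z of (a, b) \<Rightarrow> ennreal ((1 + \<bar>a\<bar> / \<tau>) powr (- 1 / 4) * min 1 (exp ((\<bar>a\<bar> - \<bar>b\<bar>) / \<tau>)))
        * (ennreal ((1 + u + \<bar>a\<bar>) powr (- \<sigma>)) * indicator {..0} a))" for z :: "real \<times> real"
    define E where "E z = exp (- \<bar>fst z\<bar> / (2 * \<tau>)) * exp (- \<bar>snd z\<bar> / \<tau>)" for z :: "real \<times> real"
    \<comment> \<open>\<open>h E\<close> bounds the kernel times \<open>japanese (u - a)\<close> for \<open>a > u\<close>; the ratio \<open>c / B\<close> balances the two
      squares in the pointwise form of the Cauchy--Schwarz inequality.\<close>
    define \<alpha>0 where "\<alpha>0 = C / \<tau>\<^sup>2 * (c * 2 powr \<sigma>)"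
    define \<alpha>1 where "\<alpha>1 = C / \<tau>\<^sup>2 * c * L * \<beta>"
    define h where "h = C / \<tau>\<^sup>2 * D * \<beta>"
    define \<alpha>2 where "\<alpha>2 = h\<^sup>2 * (c / B) / 2"
    define \<gamma> where "\<gamma> = B / c / 2"
    have nonneg: "0 \<le> \<alpha>0" "0 \<le> \<alpha>1" "0 \<le> \<alpha>2" "0 \<le> \<gamma>" "0 \<le> h"
      using C c L \<beta> B D by (auto simp: \<alpha>0_def \<alpha>1_def \<alpha>2_def \<gamma>_def h_def)
    have E: "0 \<le> E z" "E z \<le> 1" for z
      using \<tau> by (auto simp: E_def intro!: mult_le_one)
    let ?f = "Phi_integrand \<phi> x y t"
    let ?p = "(u, y)"
    have f_eq: "norm (?f (a, b)) = norm (Airy_kernel a b t) * \<bar>\<phi> (u - a) (y - b)\<bar>" for a b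
      by (simp add: Phi_integrand_def u_def norm_mult)
    have \<phi>_le: "\<bar>\<phi> v v'\<bar> \<le> c * 2 powr \<sigma> * (1 + v) powr (- \<sigma>)" if "v > 0" for v v'
    proof -
      have "\<bar>\<phi> v v'\<bar> \<le> c * japanese v powr (- \<sigma>)"
        using adm that by (simp add: admissible_def)
      also have "\<dots> \<le> c * (2 powr \<sigma> * (1 + \<bar>v\<bar>) powr (- \<sigma>))"
        using c \<sigma> by (intro mult_left_mono japanese_powr_neg_le) auto
      finally show ?thesis using that by simp
    qed
    have pointwise: "ennreal (norm (?f z)) \<le> ennreal \<alpha>0 * M z + ennreal (\<alpha>1 + \<alpha>2) * ennreal (E z)
        + ennreal \<gamma> * ennreal (weighted_sq \<phi> (?p - z))" if z_ne: "fst z \<noteq> u" for z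
    proof -
      obtain a b where z: "z = (a, b)" by (cases z)
      consider "a \<le> 0" | "0 < a" "a < u" | "u < a" using z_ne z by force
      then show ?thesis
      proof cases
        case 1
        have "norm (?f z) \<le> (C / \<tau>\<^sup>2 * ((1 + \<bar>a\<bar> / \<tau>) powr (- 1 / 4) * min 1 (exp ((\<bar>a\<bar> - \<bar>b\<bar>) / \<tau>))))
            * (c * 2 powr \<sigma> * (1 + (u - a)) powr (- \<sigma>))"
          unfolding z f_eq using 1 w x t C by (intro mult_mono neg[OF t 1 \<tau>_def] \<phi>_le) (auto simp: u_def)
        also have "\<dots> = \<alpha>0 * ((1 + \<bar>a\<bar> / \<tau>) powr (- 1 / 4) * min 1 (exp ((\<bar>a\<bar> - \<bar>b\<bar>) / \<tau>))
            * (1 + u + \<bar>a\<bar>) powr (- \<sigma>))"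
          using 1 by (simp add: \<alpha>0_def mult_ac add_diff_eq)
        finally have "ennreal (norm (?f z)) \<le> ennreal (\<alpha>0 * ((1 + \<bar>a\<bar> / \<tau>) powr (- 1 / 4) * min 1 (exp ((\<bar>a\<bar> - \<bar>b\<bar>) / \<tau>))
            * (1 + u + \<bar>a\<bar>) powr (- \<sigma>)))"
          by (rule ennreal_leI)
        also have "\<dots> = ennreal \<alpha>0 * M z"
          unfolding M_def z using 1 nonneg(1) by (simp add: ennreal_mult)
        also have "\<dots> \<le> ennreal \<alpha>0 * M z + ennreal (\<alpha>1 + \<alpha>2) * ennreal (E z)
            + ennreal \<gamma> * ennreal (weighted_sq \<phi> (?p - z))"
          by (simp add: add.assoc)
        finally show ?thesis .
      next
        case 2
        have nf: "exp (- a / \<tau>) * (1 + (u - a)) powr (- \<sigma>) \<le> (2 powr \<sigma> + D) * \<beta> * exp (- a / (2 * \<tau>))"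
          unfolding \<beta>_def w_def using 2 \<sigma> \<tau> D w sb(1)
          by (intro near_field_weight_le decay) (auto simp: w_def)
        have "norm (?f z) \<le> (C / \<tau>\<^sup>2 * (exp (- \<bar>a\<bar> / \<tau>) * exp (- \<bar>b\<bar> / \<tau>)))
            * (c * 2 powr \<sigma> * (1 + (u - a)) powr (- \<sigma>))"
          unfolding z f_eq using 2 C by (intro mult_mono pos[OF t _ \<tau>_def] \<phi>_le) auto
        also have "\<dots> = C / \<tau>\<^sup>2 * c * 2 powr \<sigma> * (exp (- a / \<tau>) * (1 + (u - a)) powr (- \<sigma>)) * exp (- \<bar>b\<bar> / \<tau>)"
          using 2 by (simp add: mult_ac)
        also have "\<dots> \<le> C / \<tau>\<^sup>2 * c * 2 powr \<sigma> * ((2 powr \<sigma> + D) * \<beta> * exp (- a / (2 * \<tau>))) * exp (- \<bar>b\<bar> / \<tau>)"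
          using nf C c by (intro mult_right_mono mult_left_mono) auto
        also have "\<dots> = \<alpha>1 * E z"
          using 2 by (simp add: \<alpha>1_def E_def L_def z mult_ac)
        also have "\<dots> \<le> (\<alpha>1 + \<alpha>2) * E z"
          using nonneg E by (intro mult_right_mono) auto
        finally have "ennreal (norm (?f z)) \<le> ennreal ((\<alpha>1 + \<alpha>2) * E z)" by (rule ennreal_leI)
        also have "\<dots> = ennreal (\<alpha>1 + \<alpha>2) * ennreal (E z)"
          using nonneg E by (simp add: ennreal_mult)
        also have "\<dots> \<le> ennreal \<alpha>0 * M z + ennreal (\<alpha>1 + \<alpha>2) * ennreal (E z)
            + ennreal \<gamma> * ennreal (weighted_sq \<phi> (?p - z))"
          by (metis add.commute add_increasing add_increasing2 order_refl zero_le)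
        finally show ?thesis .
      next
        case 3
        define \<psi> where "\<psi> = inverse (japanese (u - a)) * \<bar>\<phi> (u - a) (y - b)\<bar>"
        have j: "japanese (u - a) > 0" using japanese_ge(1)[of "u - a"] by simp
        have "w powr (1 / 3) \<le> (1 + a) powr (1 / 3)"
          using 3 w by (intro powr_mono2) (auto simp: w_def)
        then have \<tau>_le: "\<tau> \<le> 3 * (1 + a) powr (1 / 3)" using sb(1) by simp
        have ff: "exp (- a / \<tau>) * japanese (u - a) \<le> D * \<beta> * exp (- a / (2 * \<tau>))"
          unfolding \<beta>_def w_def using 3 \<sigma> \<tau> D w \<tau>_le
          by (intro far_field_weight_le decay) auto
        have ws: "weighted_sq \<phi> (?p - z) = \<psi>\<^sup>2"
          using 3 by (simp add: weighted_sq_def z \<psi>_def power_mult_distrib)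
        have "norm (?f z) = norm (Airy_kernel a b t) * japanese (u - a) * \<psi>"
          using j by (simp add: z f_eq \<psi>_def)
        also have "\<dots> \<le> (C / \<tau>\<^sup>2 * (exp (- \<bar>a\<bar> / \<tau>) * exp (- \<bar>b\<bar> / \<tau>))) * japanese (u - a) * \<psi>"
          using 3 w j by (intro mult_right_mono pos[OF t _ \<tau>_def]) (auto simp: \<psi>_def)
        also have "\<dots> = C / \<tau>\<^sup>2 * (exp (- a / \<tau>) * japanese (u - a)) * exp (- \<bar>b\<bar> / \<tau>) * \<psi>"
          using 3 w by (simp add: mult_ac)
        also have "\<dots> \<le> C / \<tau>\<^sup>2 * (D * \<beta> * exp (- a / (2 * \<tau>))) * exp (- \<bar>b\<bar> / \<tau>) * \<psi>"
          using ff C j by (intro mult_right_mono mult_left_mono) (auto simp: \<psi>_def)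
        also have "\<dots> = (h * E z) * \<psi>"
          using 3 w by (simp add: h_def E_def z mult_ac)
        also have "\<dots> \<le> ((h * E z)\<^sup>2 * (c / B) + \<psi>\<^sup>2 / (c / B)) / 2"
          using c B by (intro mult_le_half_sum_squares) auto
        also have "(h * E z)\<^sup>2 \<le> h\<^sup>2 * E z"
        proof -
          have "h\<^sup>2 * (E z)\<^sup>2 \<le> h\<^sup>2 * E z"
            using E[of z] by (intro mult_left_mono) (auto simp: power2_eq_square mult_left_le)
          then show ?thesis by (simp add: power_mult_distrib)
        qed
        also have "(h\<^sup>2 * E z * (c / B) + \<psi>\<^sup>2 / (c / B)) / 2 = \<alpha>2 * E z + \<gamma> * \<psi>\<^sup>2"
          using c B by (simp add: \<alpha>2_def \<gamma>_def field_simps)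
        also have "\<dots> \<le> (\<alpha>1 + \<alpha>2) * E z + \<gamma> * \<psi>\<^sup>2"
          using nonneg E by (intro add_right_mono mult_right_mono) auto
        finally have "norm (?f z) \<le> (\<alpha>1 + \<alpha>2) * E z + \<gamma> * \<psi>\<^sup>2"
          using c B by (simp add: divide_right_mono mult_right_mono)
        then have "ennreal (norm (?f z)) \<le> ennreal ((\<alpha>1 + \<alpha>2) * E z + \<gamma> * \<psi>\<^sup>2)" by (rule ennreal_leI)
        also have "\<dots> = ennreal (\<alpha>1 + \<alpha>2) * ennreal (E z) + ennreal \<gamma> * ennreal (weighted_sq \<phi> (?p - z))"
          using nonneg E by (simp add: ennreal_plus ennreal_mult ws)
        also have "\<dots> \<le> ennreal \<alpha>0 * M z + ennreal (\<alpha>1 + \<alpha>2) * ennreal (E z)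
            + ennreal \<gamma> * ennreal (weighted_sq \<phi> (?p - z))"
          by (simp add: add.assoc)
        finally show ?thesis .
      qed
    qed
    have M_meas: "M \<in> borel_measurable borel"
      unfolding M_def borel_prod[symmetric] by measurable
    have E_meas: "E \<in> borel_measurable borel"
      unfolding E_def borel_prod[symmetric] by measurable
    have W_meas: "(\<lambda>z. ennreal (weighted_sq \<phi> (?p - z))) \<in> borel_measurable lebesgue"
      using measurable_compose[OF lebesgue_measurable_reflect borel_measurable_integrable[OF weighted_sq_integral(1)[OF adm c]]]
      by simp
    \<comment> \<open>At a = u the data is evaluated on the line of first coordinate 0, where
      admissibility gives no bound; this line is null.\<close>
    have "AE z in (lborel :: (real \<times> real) measure). fst z \<noteq> u"
    proof -
      have "AE a in lborel. AE b in (lborel :: real measure). fst (a, b) \<noteq> u"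
        using AE_lborel_singleton[of u] by eventually_elim simp
      moreover have "fst -` (- {u}) \<inter> space (lborel \<Otimes>\<^sub>M lborel) \<in> sets (lborel \<Otimes>\<^sub>M (lborel :: real measure))"
        by (rule measurable_sets[OF measurable_fst]) simp
      then have "{z \<in> space (lborel \<Otimes>\<^sub>M (lborel :: real measure)). fst z \<noteq> u} \<in> sets (lborel \<Otimes>\<^sub>M lborel)"
        by (simp add: vimage_def Int_def conj_commute)
      ultimately have "AE z in lborel \<Otimes>\<^sub>M (lborel :: real measure). fst z \<noteq> u"
        by (rule lborel_pair.AE_pair_measure[rotated])
      then show ?thesis unfolding lborel_prod .
    qed
    then have "AE z in (lebesgue :: (real \<times> real) measure). fst z \<noteq> u" by (rule AE_completion)
    then have "(\<integral>\<^sup>+z. ennreal (norm (?f z)) \<partial>lebesgue) \<le> (\<integral>\<^sup>+z. ennreal \<alpha>0 * M z + ennreal (\<alpha>1 + \<alpha>2) * ennreal (E z)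
        + ennreal \<gamma> * ennreal (weighted_sq \<phi> (?p - z)) \<partial>lebesgue)"
      by (intro nn_integral_mono_AE) (auto elim!: eventually_mono intro: pointwise)
    also have "\<dots> = ennreal \<alpha>0 * (\<integral>\<^sup>+z. M z \<partial>lborel) + ennreal (\<alpha>1 + \<alpha>2) * (\<integral>\<^sup>+z. ennreal (E z) \<partial>lborel)
        + ennreal \<gamma> * (\<integral>\<^sup>+z. ennreal (weighted_sq \<phi> (?p - z)) \<partial>lebesgue)"
    \<comment> \<open>\<open>M\<close> and \<open>E\<close> are Borel, so their integrals pass to
      \<open>lborel\<close>, where Fubini was used; the term with \<phi> stays with the completed
      measure.\<close>
    proof -
      have [measurable]: "M \<in> borel_measurable lebesgue" "E \<in> borel_measurable lebesgue"
        using M_meas E_meas by (auto intro: measurable_completion)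
      note [measurable] = W_meas
      show ?thesis
        by (simp add: nn_integral_add nn_integral_cmult flip: nn_integral_completion[of lborel])
    qed
    also have "\<dots> \<le> ennreal \<alpha>0 * ennreal (12 / (\<sigma> - 7 / 4) * \<tau> powr (1 / 4) * (1 + u) powr (7 / 4 - \<sigma>))
        + ennreal (\<alpha>1 + \<alpha>2) * ennreal (8 * \<tau>\<^sup>2) + ennreal \<gamma> * ennreal (c\<^sup>2)"
    proof (intro add_mono mult_left_mono)
      show "(\<integral>\<^sup>+z. M z \<partial>lborel) \<le> ennreal (12 / (\<sigma> - 7 / 4) * \<tau> powr (1 / 4) * (1 + u) powr (7 / 4 - \<sigma>))"
        unfolding M_def using \<sigma> w \<tau> sb(2) by (intro nn_integral_cone_le) (auto simp: w_def)
      show "(\<integral>\<^sup>+z. ennreal (E z) \<partial>lborel) \<le> ennreal (8 * \<tau>\<^sup>2)"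
        using nn_integral_exp_abs_pair[OF \<tau>] by (simp add: E_def case_prod_beta')
      have "(\<integral>\<^sup>+z. ennreal (weighted_sq \<phi> (?p - z)) \<partial>lebesgue)
          = (\<integral>\<^sup>+z. ennreal (weighted_sq \<phi> z) \<partial>distr lebesgue lebesgue (\<lambda>z. ?p - z))"
        using weighted_sq_integral(1)[OF adm c]
        by (intro nn_integral_distr[symmetric] lebesgue_measurable_reflect) auto
      then show "(\<integral>\<^sup>+z. ennreal (weighted_sq \<phi> (?p - z)) \<partial>lebesgue) \<le> ennreal (c\<^sup>2)"
        using weighted_sq_integral(2)[OF adm c] by (simp only: distr_lebesgue_reflect)
    qed auto
    also have "\<dots> = ennreal (\<alpha>0 * (12 / (\<sigma> - 7 / 4) * \<tau> powr (1 / 4) * w powr (7 / 4 - \<sigma>))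
        + (\<alpha>1 + \<alpha>2) * (8 * \<tau>\<^sup>2) + \<gamma> * c\<^sup>2)"
    proof -
      have lin: "ennreal p1 * ennreal q1 + ennreal p2 * ennreal q2 + ennreal p3 * ennreal q3
          = ennreal (p1 * q1 + p2 * q2 + p3 * q3)"
        if "0 \<le> p1" "0 \<le> q1" "0 \<le> p2" "0 \<le> q2" "0 \<le> p3" "0 \<le> q3" for p1 q1 p2 q2 p3 q3
        using that by (simp add: ennreal_mult ennreal_plus)
      show ?thesis unfolding w_def using nonneg \<sigma> by (intro lin) auto
    qed
    also have "\<dots> \<le> ennreal (K * c * B)"
    proof (intro ennreal_leI)
      have "\<alpha>0 * (12 / (\<sigma> - 7 / 4) * \<tau> powr (1 / 4) * w powr (7 / 4 - \<sigma>))
          = C * 2 powr \<sigma> * (12 / (\<sigma> - 7 / 4)) * c * ((\<tau> powr (1 / 4) / \<tau>\<^sup>2) * w powr (7 / 4 - \<sigma>))"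
        by (simp add: \<alpha>0_def mult_ac)
      also have "\<dots> \<le> C * 2 powr \<sigma> * (12 / (\<sigma> - 7 / 4)) * c * B"
        unfolding B_def using sb(3) C c \<sigma> by (intro mult_left_mono mult_right_mono) auto
      finally have 1: "\<alpha>0 * (12 / (\<sigma> - 7 / 4) * \<tau> powr (1 / 4) * w powr (7 / 4 - \<sigma>))
          \<le> C * 2 powr \<sigma> * (12 / (\<sigma> - 7 / 4)) * c * B" .
      have "\<alpha>1 * (8 * \<tau>\<^sup>2) = 8 * C * L * c * \<beta>" using \<tau> by (simp add: \<alpha>1_def)
      also have "\<dots> \<le> 8 * C * L * c * B" using sb(4) C c L by (intro mult_left_mono) auto
      finally have 2: "\<alpha>1 * (8 * \<tau>\<^sup>2) \<le> 8 * C * L * c * B" .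
      \<comment> \<open>The choice r = c/B makes this half and \<open>\<gamma> * c\<^sup>2\<close>
        both of order c B, hence linear in c.\<close>
      have "\<alpha>2 * (8 * \<tau>\<^sup>2) = 4 * C\<^sup>2 * D\<^sup>2 * c * ((\<beta> / \<tau>)\<^sup>2 / B)"
        using \<tau> B by (simp add: \<alpha>2_def h_def power2_eq_square field_simps)
      also have "\<dots> \<le> 4 * C\<^sup>2 * D\<^sup>2 * c * (B\<^sup>2 / B)"
        using sb(5) c B \<tau> \<beta> by (intro mult_left_mono divide_right_mono power_mono) auto
      also have "B\<^sup>2 / B = B" by (simp add: power2_eq_square)
      finally have 3: "\<alpha>2 * (8 * \<tau>\<^sup>2) \<le> 4 * C\<^sup>2 * D\<^sup>2 * c * B" .
      have 4: "\<gamma> * c\<^sup>2 = 1 / 2 * c * B" using c by (simp add: \<gamma>_def power2_eq_square)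
      have "K * c * B = C * 2 powr \<sigma> * (12 / (\<sigma> - 7 / 4)) * c * B + 8 * C * L * c * B
          + 4 * C\<^sup>2 * D\<^sup>2 * c * B + 1 / 2 * c * B"
        unfolding K_def by (simp only: distrib_right)
      with 1 2 3 4 show "\<alpha>0 * (12 / (\<sigma> - 7 / 4) * \<tau> powr (1 / 4) * w powr (7 / 4 - \<sigma>))
        + (\<alpha>1 + \<alpha>2) * (8 * \<tau>\<^sup>2) + \<gamma> * c\<^sup>2 \<le> K * c * B"
        unfolding distrib_right by linarith
    qed
    finally show "(\<integral>\<^sup>+z. ennreal (norm (?f z)) \<partial>lebesgue)
        \<le> ennreal (K * c * (t powr (- 7 / 12) * (1 + x + t) powr (7 / 4 - \<sigma>)))"
      by (simp add: B_def w_def u_def add.assoc)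
  qed
qed

text \<open>Integrability is asserted along with the bounds because a divergent Bochner integral has
  value 0. The constant is chosen before the data and the point, which expresses uniformity.\<close>

theorem proposition10p1:
  fixes \<sigma> :: real
  assumes "\<sigma> > 9 / 4"
  shows "\<exists>K>0. \<forall>\<phi> C\<^sub>1. C\<^sub>1 > 0 \<longrightarrow> admissible \<sigma> C\<^sub>1 \<phi> \<longrightarrow>
    (\<forall>x y t. t > 0 \<longrightarrow> x > 0 \<longrightarrow>
       integrable lebesgue (Phi_integrand \<phi> x y t) \<and>
       (t < 1 \<longrightarrow> cmod (Phi \<phi> x y t)
          \<le> K * C\<^sub>1 * (t powr (- 7 / 12) * japanese x powr (- \<sigma> + 7 / 4))) \<and>
       (t > 1 \<longrightarrow> cmod (Phi \<phi> x y t)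
          \<le> K * C\<^sub>1 * (t powr (- 13 / 12) *
               japanese x powr (- min (2 / 3 * \<sigma> - 3 / 4) (\<sigma> - 9 / 4)))))"
proof -
  obtain K where K: "K > 0" and bound: "\<And>\<phi> c x y t. 0 < c \<Longrightarrow> admissible \<sigma> c \<phi> \<Longrightarrow> 0 < t \<Longrightarrow> 0 < x \<Longrightarrow>
    (\<integral>\<^sup>+z. ennreal (norm (Phi_integrand \<phi> x y t z)) \<partial>lebesgue)
      \<le> ennreal (K * c * (t powr (- 7 / 12) * (1 + x + t) powr (7 / 4 - \<sigma>)))"
    using Phi_integrand_bound[OF assms] by blast
  have main: "integrable lebesgue (Phi_integrand \<phi> x y t) \<and>
       (t < 1 \<longrightarrow> cmod (Phi \<phi> x y t)
          \<le> K * c * (t powr (- 7 / 12) * japanese x powr (- \<sigma> + 7 / 4))) \<and>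
       (t > 1 \<longrightarrow> cmod (Phi \<phi> x y t)
          \<le> K * c * (t powr (- 13 / 12) *
               japanese x powr (- min (2 / 3 * \<sigma> - 3 / 4) (\<sigma> - 9 / 4))))"
    if c: "0 < c" and adm: "admissible \<sigma> c \<phi>" and t: "0 < t" and x: "0 < x" for \<phi> c x y t
  proof (intro conjI impI)
    note b = bound[OF c adm t x, of y]
    let ?w = "1 + x + t"
    show int: "integrable lebesgue (Phi_integrand \<phi> x y t)"
      using Phi_integrand_measurable[OF adm t] order.strict_trans1[OF b ennreal_less_top]
      by (intro integrableI_bounded) auto
    have "ennreal (cmod (Phi \<phi> x y t)) \<le> ennreal (K * c * (t powr (- 7 / 12) * ?w powr (7 / 4 - \<sigma>)))"
      unfolding Phi_def using integral_norm_bound_ennreal[OF int] b by (rule order_trans)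
    then have le: "cmod (Phi \<phi> x y t) \<le> K * c * (t powr (- 7 / 12) * ?w powr (7 / 4 - \<sigma>))"
      using K c by (subst (asm) ennreal_le_iff) auto
    have j: "1 \<le> japanese x" "japanese x \<le> ?w"
      using japanese_ge[of x] x t by auto
    show "cmod (Phi \<phi> x y t) \<le> K * c * (t powr (- 7 / 12) * japanese x powr (- \<sigma> + 7 / 4))"
    proof -
      have "?w powr (7 / 4 - \<sigma>) \<le> japanese x powr (- \<sigma> + 7 / 4)"
        using powr_mono2'[of "7 / 4 - \<sigma>" "japanese x" ?w] j assms by simp
      then show ?thesis
        using K c by (intro order_trans[OF le] mult_left_mono) auto
    qed
    show "cmod (Phi \<phi> x y t) \<le> K * c * (t powr (- 13 / 12) *
               japanese x powr (- min (2 / 3 * \<sigma> - 3 / 4) (\<sigma> - 9 / 4)))"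
    proof -
      \<comment> \<open>The first factor is bounded through w \<ge> t and turns -7/12 into -13/12;
        the second through w \<ge> \<open>japanese x\<close>, where \<sigma> > 9/4 makes the
        exponent negative.\<close>
      have "?w powr (7 / 4 - \<sigma>) = ?w powr (- 1 / 2) * ?w powr (9 / 4 - \<sigma>)"
        by (simp add: powr_add[symmetric])
      also have "\<dots> \<le> t powr (- 1 / 2) * japanese x powr (9 / 4 - \<sigma>)"
        using x t j assms by (intro mult_mono powr_mono2') auto
      \<comment> \<open>The base is at least 1 and the minimum is at most \<sigma> - 9/4.\<close>
      also have "\<dots> \<le> t powr (- 1 / 2) * japanese x powr (- min (2 / 3 * \<sigma> - 3 / 4) (\<sigma> - 9 / 4))"
        using j by (intro mult_left_mono powr_mono) auto
      finally have "t powr (- 7 / 12) * ?w powr (7 / 4 - \<sigma>)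
          \<le> t powr (- 7 / 12) * (t powr (- 1 / 2) * japanese x powr (- min (2 / 3 * \<sigma> - 3 / 4) (\<sigma> - 9 / 4)))"
        by (intro mult_left_mono) auto
      also have "\<dots> = t powr (- 13 / 12) * japanese x powr (- min (2 / 3 * \<sigma> - 3 / 4) (\<sigma> - 9 / 4))"
        by (simp add: mult.assoc[symmetric] powr_add[symmetric])
      finally show ?thesis
        using K c by (intro order_trans[OF le] mult_left_mono) auto
    qed
  qed
  show ?thesis
    by (rule exI[of _ K]) (use K main in blast)
qed

end
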